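(* Let $(M^2,g)$ be a compact Hermitian surface (complex dimension $2$), let $k\in\{1,2,3,4\}$, and let $\alpha,\beta\in\mathbb{R}$ with $\beta\neq 0$. Suppose the $k$th-mixed curvature of $g$ is constant, i.e. there is a constant $c$ with $\mathcal{C}^{(k)}_{\alpha,\beta}(X)=c$ for every point $p\in M$ and every nonzero $X\in T^{1,0}_pM$. Then $(M,g)$ is self-dual.
   Context: For a Hermitian manifold $(M^n,g)$ of complex dimension $n$, let $R$ be the curvature tensor of the Chern connection; in local holomorphic coordinates $$R_{i\bar j k\bar l}=-\frac{\partial^2 g_{k\bar l}}{\partial z^i\partial\bar z^j}+g^{p\bar q}\frac{\partial g_{k\bar q}}{\partial z^i}\frac{\partial g_{p\bar l}}{\partial\bar z^j}.$$ The four Chern Ricci curvatures are $$Ric^{(1)}_{i\bar j}=g^{k\bar l}R_{i\bar jk\bar l},\quad Ric^{(2)}_{k\bar l}=g^{i\bar j}R_{i\bar jk\bar l},\quad Ric^{(3)}_{i\bar l}=g^{k\bar j}R_{i\bar jk\bar l},\quad Ric^{(4)}_{k\bar j}=g^{i\bar l}R_{i\bar jk\bar l}.$$ The holomorphic sectional curvature is $H(X)=R(X,\bar X,X,\bar X)/|X|_g^4$ for nonzero $X\in T^{1,0}M$. For $\alpha,\beta\in\mathbb{R}$ and $k\in\{1,2,3,4\}$ the $k$th-mixed curvature is $$\mathcal{C}^{(k)}_{\alpha,\beta}(X)=\frac{\alpha}{|X|_g^2}Ric^{(k)}(X,\bar X)+\beta H(X),\qquad 0\ne X\in T^{1,0}M.$$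 A Hermitian surface is self-dual if, for the orientation induced by the complex structure, the anti-self-dual part $W^-$ of the Weyl tensor $W=W^++W^-$ of the underlying Riemannian metric vanishes identically. *)

theory Defs
  imports "HOL-Analysis.Analysis"
begin

section \<open>Partial derivatives and smooth functions\<close>

definition pd :: "'b::real_normed_vector \<Rightarrow> ('b \<Rightarrow> 'c::real_normed_vector) \<Rightarrow> 'b \<Rightarrow> 'c" where
  "pd v f z = frechet_derivative f (at z) v"

text \<open>Intended for open \<open>S\<close>: all iterated directional derivatives of \<open>f\<close> exist and are
  differentiable (hence continuous) on \<open>S\<close>, that is, \<open>f\<close> is of class \<open>C\<^sup>\<infinity>\<close> on \<open>S\<close>.\<close>

definition smooth_fun_on :: "'b::real_normed_vector set \<Rightarrow> ('b \<Rightarrow> 'c::real_normed_vector) \<Rightarrow> bool" where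
  "smooth_fun_on S f \<longleftrightarrow> (\<forall>vs. foldr pd vs f differentiable_on S)"

text \<open>Holomorphic maps of several variables, for open \<open>S\<close>: the derivative is complex linear.\<close>

definition holo_map_on :: "(complex^'n) set \<Rightarrow> (complex^'n \<Rightarrow> complex^'m) \<Rightarrow> bool" where
  "holo_map_on S f \<longleftrightarrow> (\<forall>z\<in>S. \<exists>A::complex^'n^'m. (f has_derivative (\<lambda>v. A *v v)) (at z))"

text \<open>\<open>\<partial>/\<partial>z\<^sup>i\<close> and \<open>\<partial>/\<partial>\<bar>z\<^sup>i\<close>, where \<open>axis i 1\<close> and \<open>axis i \<i>\<close> are the directions
  \<open>\<partial>/\<partial>x\<^sup>i\<close> and \<open>\<partial>/\<partial>y\<^sup>i\<close>.\<close>

definition dz :: "'n::finite \<Rightarrow> (complex^'n \<Rightarrow> complex) \<Rightarrow> complex^'n \<Rightarrow> complex" where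
  "dz i f z = (pd (axis i 1) f z - \<i> * pd (axis i \<i>) f z) / 2"

definition dzbar :: "'n::finite \<Rightarrow> (complex^'n \<Rightarrow> complex) \<Rightarrow> complex^'n \<Rightarrow> complex" where
  "dzbar i f z = (pd (axis i 1) f z + \<i> * pd (axis i \<i>) f z) / 2"


section \<open>Hermitian manifolds\<close>

text \<open>A chart is a pair of a domain and a coordinate map; the values of the map outside the
  domain are irrelevant.\<close>

type_synonym ('a, 'n) chart = "'a set \<times> ('a \<Rightarrow> complex^'n)"

definition chart_image :: "('a, 'n) chart \<Rightarrow> (complex^'n) set" where
  "chart_image c = snd c ` fst c"

definition transition :: "('a, 'n) chart \<Rightarrow> ('a, 'n) chart \<Rightarrow> complex^'n \<Rightarrow> complex^'n" where
  "transition c d = snd d \<circ> inv_into (fst c) (snd c)"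

locale complex_manifold =
  fixes M :: "'a topology" and A :: "('a, 'n::finite) chart set"
  assumes hausdorff: "Hausdorff_space M"
    and second_countable: "second_countable M"
    and chart_dom_open: "\<And>c. c \<in> A \<Longrightarrow> openin M (fst c)"
    and chart_image_open: "\<And>c. c \<in> A \<Longrightarrow> open (chart_image c)"
    and chart_homeo: "\<And>c. c \<in> A \<Longrightarrow>
      homeomorphic_map (subtopology M (fst c)) (top_of_set (chart_image c)) (snd c)"
    and charts_cover: "(\<Union>c\<in>A. fst c) = topspace M"
    and transition_holo: "\<And>c d. c \<in> A \<Longrightarrow> d \<in> A \<Longrightarrow>
      holo_map_on (snd c ` (fst c \<inter> fst d)) (transition c d)"

text \<open>A matrix \<open>h\<close> holds the components \<open>g\<^bsub>k l-bar\<^esub> = g(\<partial>/\<partial>z\<^sup>k, \<partial>/\<partial>\<bar>z\<^sup>l)\<close> as \<open>h $ k $ l\<close>;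
  \<open>herm h X Y\<close> is \<open>g(X, \<bar>Y)\<close> for the \<open>(1,0)\<close>-vectors with components \<open>X\<close> and \<open>Y\<close>.\<close>

definition herm :: "complex^'n^'n \<Rightarrow> complex^'n \<Rightarrow> complex^'n \<Rightarrow> complex" where
  "herm h X Y = (\<Sum>k\<in>UNIV. \<Sum>l\<in>UNIV. h $ k $ l * X $ k * cnj (Y $ l))"

text \<open>A Hermitian metric is given by its component matrices \<open>g c z\<close> at the point with coordinates
  \<open>z\<close> in each chart \<open>c\<close>, subject to the tensorial transformation law.\<close>

locale hermitian_manifold = complex_manifold M A
  for M :: "'a topology" and A :: "('a, 'n::finite) chart set" +
  fixes g :: "('a, 'n) chart \<Rightarrow> complex^'n \<Rightarrow> complex^'n^'n"
  assumes metric_smooth: "\<And>c k l. c \<in> A \<Longrightarrow> smooth_fun_on (chart_image c) (\<lambda>z. g c z $ k $ l)"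
    and metric_hermitian: "\<And>c z k l. c \<in> A \<Longrightarrow> z \<in> chart_image c \<Longrightarrow>
      g c z $ l $ k = cnj (g c z $ k $ l)"
    and metric_pos: "\<And>c z X. c \<in> A \<Longrightarrow> z \<in> chart_image c \<Longrightarrow> X \<noteq> 0 \<Longrightarrow> 0 < Re (herm (g c z) X X)"
    and metric_transform: "\<And>c d p X Y. c \<in> A \<Longrightarrow> d \<in> A \<Longrightarrow> p \<in> fst c \<inter> fst d \<Longrightarrow>
      herm (g c (snd c p)) X Y =
        herm (g d (snd d p)) (pd X (transition c d) (snd c p)) (pd Y (transition c d) (snd c p))"


section \<open>Chern curvature\<close>

text \<open>In this section \<open>h\<close> is the field of component matrices of the metric in a coordinate domain.
  \<open>g_inv h z k l\<close> is \<open>g\<^bsup>k l-bar\<^esup>\<close>, normalised by \<open>\<Sum>l. g\<^bsup>k l-bar\<^esup> g\<^bsub>m l-bar\<^esub> = \<delta>\<^bsub>k m\<^esub>\<close>; hence the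
  transposition.\<close>

definition g_inv :: "(complex^'n \<Rightarrow> complex^'n^'n) \<Rightarrow> complex^'n \<Rightarrow> 'n \<Rightarrow> 'n \<Rightarrow> complex" where
  "g_inv h z k l = matrix_inv (h z) $ l $ k"

text \<open>\<open>chern_curv h z i j k l\<close> is \<open>R\<^bsub>i j-bar k l-bar\<^esub>\<close>.\<close>

definition chern_curv ::
  "(complex^'n \<Rightarrow> complex^'n^'n) \<Rightarrow> complex^'n \<Rightarrow> 'n \<Rightarrow> 'n \<Rightarrow> 'n \<Rightarrow> 'n \<Rightarrow> complex" where
  "chern_curv h z i j k l =
     - dz i (dzbar j (\<lambda>w. h w $ k $ l)) z
     + (\<Sum>p\<in>UNIV. \<Sum>q\<in>UNIV. g_inv h z p q *
          dz i (\<lambda>w. h w $ k $ q) z * dzbar j (\<lambda>w. h w $ p $ l) z)"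

definition chern_ricci1 :: "(complex^'n \<Rightarrow> complex^'n^'n) \<Rightarrow> complex^'n \<Rightarrow> 'n \<Rightarrow> 'n \<Rightarrow> complex" where
  "chern_ricci1 h z i j = (\<Sum>k\<in>UNIV. \<Sum>l\<in>UNIV. g_inv h z k l * chern_curv h z i j k l)"

definition chern_ricci2 :: "(complex^'n \<Rightarrow> complex^'n^'n) \<Rightarrow> complex^'n \<Rightarrow> 'n \<Rightarrow> 'n \<Rightarrow> complex" where
  "chern_ricci2 h z k l = (\<Sum>i\<in>UNIV. \<Sum>j\<in>UNIV. g_inv h z i j * chern_curv h z i j k l)"

definition chern_ricci3 :: "(complex^'n \<Rightarrow> complex^'n^'n) \<Rightarrow> complex^'n \<Rightarrow> 'n \<Rightarrow> 'n \<Rightarrow> complex" where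
  "chern_ricci3 h z i l = (\<Sum>k\<in>UNIV. \<Sum>j\<in>UNIV. g_inv h z k j * chern_curv h z i j k l)"

definition chern_ricci4 :: "(complex^'n \<Rightarrow> complex^'n^'n) \<Rightarrow> complex^'n \<Rightarrow> 'n \<Rightarrow> 'n \<Rightarrow> complex" where
  "chern_ricci4 h z k j = (\<Sum>i\<in>UNIV. \<Sum>l\<in>UNIV. g_inv h z i l * chern_curv h z i j k l)"

text \<open>Only the indices \<open>1, 2, 3, 4\<close> are meaningful.\<close>

definition chern_ricci :: "nat \<Rightarrow> (complex^'n \<Rightarrow> complex^'n^'n) \<Rightarrow> complex^'n \<Rightarrow> 'n \<Rightarrow> 'n \<Rightarrow> complex" where
  "chern_ricci k =
     (if k = 1 then chern_ricci1 else if k = 2 then chern_ricci2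
      else if k = 3 then chern_ricci3 else chern_ricci4)"

definition hol_sect_curv :: "(complex^'n \<Rightarrow> complex^'n^'n) \<Rightarrow> complex^'n \<Rightarrow> complex^'n \<Rightarrow> complex" where
  "hol_sect_curv h z X =
     (\<Sum>i\<in>UNIV. \<Sum>j\<in>UNIV. \<Sum>k\<in>UNIV. \<Sum>l\<in>UNIV.
        chern_curv h z i j k l * X $ i * cnj (X $ j) * X $ k * cnj (X $ l))
     / (herm (h z) X X)\<^sup>2"

text \<open>The value is complex because the third and fourth Ricci curvatures need not be Hermitian
  when the metric is not Kaehler. Here \<open>herm (h z) X X\<close> is \<open>|X|\<^sub>g\<^sup>2\<close>.\<close>

definition mixed_curv ::
  "nat \<Rightarrow> real \<Rightarrow> real \<Rightarrow> (complex^'n \<Rightarrow> complex^'n^'n) \<Rightarrow> complex^'n \<Rightarrow> complex^'n \<Rightarrow> complex" where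
  "mixed_curv k \<alpha> \<beta> h z X =
     of_real \<alpha> / herm (h z) X X * (\<Sum>a\<in>UNIV. \<Sum>b\<in>UNIV. chern_ricci k h z a b * X $ a * cnj (X $ b))
     + of_real \<beta> * hol_sect_curv h z X"

text \<open>The tangent vectors in \<open>T\<^sup>1\<^sup>,\<^sup>0M\<close> at \<open>p\<close> are given by their components \<open>X\<close> in a chart around \<open>p\<close>.\<close>

definition constant_mixed_curvature ::
  "('a, 'n::finite) chart set \<Rightarrow> (('a, 'n) chart \<Rightarrow> complex^'n \<Rightarrow> complex^'n^'n) \<Rightarrow>
    nat \<Rightarrow> real \<Rightarrow> real \<Rightarrow> complex \<Rightarrow> bool" where
  "constant_mixed_curvature A g k \<alpha> \<beta> C \<longleftrightarrow>
     (\<forall>c\<in>A. \<forall>p\<in>fst c. \<forall>X. X \<noteq> 0 \<longrightarrow> mixed_curv k \<alpha> \<beta> (g c) (snd c p) X = C)"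


section \<open>Levi-Civita curvature and Weyl tensor\<close>

text \<open>Here \<open>e\<close> is a basis of the vector space of coordinates, indexed by \<open>'m\<close>, and \<open>G\<close> is the field of
  component matrices of a Riemannian metric in the linear coordinates dual to \<open>e\<close>.\<close>

definition christoffel ::
  "('m::finite \<Rightarrow> 'b::real_normed_vector) \<Rightarrow> ('b \<Rightarrow> real^'m^'m) \<Rightarrow> 'm \<Rightarrow> 'm \<Rightarrow> 'm \<Rightarrow> 'b \<Rightarrow> real" where
  "christoffel e G a b c z =
     (\<Sum>d\<in>UNIV. matrix_inv (G z) $ a $ d *
        (pd (e b) (\<lambda>w. G w $ c $ d) z + pd (e c) (\<lambda>w. G w $ b $ d) z - pd (e d) (\<lambda>w. G w $ b $ c) z)) / 2"

text \<open>\<open>riem_up\<close> is \<open>R\<^sup>a\<^bsub>bcd\<^esub> = dx\<^sup>a (R(\<partial>\<^sub>c, \<partial>\<^sub>d) \<partial>\<^sub>b)\<close> with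
  \<open>R(X, Y) = [\<nabla>\<^sub>X, \<nabla>\<^sub>Y] - \<nabla>\<^bsub>[X, Y]\<^esub>\<close>; round spheres have
  \<open>R\<^bsub>abcd\<^esub> = K (G\<^bsub>ac\<^esub> G\<^bsub>bd\<^esub> - G\<^bsub>ad\<^esub> G\<^bsub>bc\<^esub>)\<close> with \<open>K > 0\<close>.\<close>

definition riem_up ::
  "('m::finite \<Rightarrow> 'b::real_normed_vector) \<Rightarrow> ('b \<Rightarrow> real^'m^'m) \<Rightarrow> 'b \<Rightarrow> 'm \<Rightarrow> 'm \<Rightarrow> 'm \<Rightarrow> 'm \<Rightarrow> real" where
  "riem_up e G z a b c d =
     pd (e c) (christoffel e G a d b) z - pd (e d) (christoffel e G a c b) z
     + (\<Sum>f\<in>UNIV. christoffel e G a c f z * christoffel e G f d b z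
                - christoffel e G a d f z * christoffel e G f c b z)"

definition riem ::
  "('m::finite \<Rightarrow> 'b::real_normed_vector) \<Rightarrow> ('b \<Rightarrow> real^'m^'m) \<Rightarrow> 'b \<Rightarrow> 'm \<Rightarrow> 'm \<Rightarrow> 'm \<Rightarrow> 'm \<Rightarrow> real" where
  "riem e G z a b c d = (\<Sum>f\<in>UNIV. G z $ a $ f * riem_up e G z f b c d)"

definition ricci ::
  "('m::finite \<Rightarrow> 'b::real_normed_vector) \<Rightarrow> ('b \<Rightarrow> real^'m^'m) \<Rightarrow> 'b \<Rightarrow> 'm \<Rightarrow> 'm \<Rightarrow> real" where
  "ricci e G z b d = (\<Sum>a\<in>UNIV. riem_up e G z a b a d)"

definition scalar_curv ::
  "('m::finite \<Rightarrow> 'b::real_normed_vector) \<Rightarrow> ('b \<Rightarrow> real^'m^'m) \<Rightarrow> 'b \<Rightarrow> real" where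
  "scalar_curv e G z = (\<Sum>b\<in>UNIV. \<Sum>d\<in>UNIV. matrix_inv (G z) $ b $ d * ricci e G z b d)"

definition weyl ::
  "('m::finite \<Rightarrow> 'b::real_normed_vector) \<Rightarrow> ('b \<Rightarrow> real^'m^'m) \<Rightarrow> 'b \<Rightarrow> 'm \<Rightarrow> 'm \<Rightarrow> 'm \<Rightarrow> 'm \<Rightarrow> real" where
  "weyl e G z a b c d =
     riem e G z a b c d
     - (G z $ a $ c * ricci e G z b d - G z $ a $ d * ricci e G z b c
        - G z $ b $ c * ricci e G z a d + G z $ b $ d * ricci e G z a c) / (real CARD('m) - 2)
     + scalar_curv e G z * (G z $ a $ c * G z $ b $ d - G z $ a $ d * G z $ b $ c)
       / ((real CARD('m) - 1) * (real CARD('m) - 2))"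


section \<open>Self-duality\<close>

text \<open>The components of the Riemannian volume form in a positively oriented frame; the second
  determinant is the Levi-Civita symbol.\<close>

definition vol_form :: "real^4^4 \<Rightarrow> 4 \<Rightarrow> 4 \<Rightarrow> 4 \<Rightarrow> 4 \<Rightarrow> real" where
  "vol_form G a b c d =
     sqrt (det G) * det (vector [axis a 1, axis b 1, axis c 1, axis d 1] :: real^4^4)"

text \<open>\<open>(\<star>\<omega>)\<^bsub>ab\<^esub> = 1/2 vol\<^bsub>abcd\<^esub> G\<^bsup>cp\<^esup> G\<^bsup>dq\<^esup> \<omega>\<^bsub>pq\<^esub>\<close>\<close>

definition hodge_star :: "real^4^4 \<Rightarrow> (4 \<Rightarrow> 4 \<Rightarrow> real) \<Rightarrow> 4 \<Rightarrow> 4 \<Rightarrow> real" where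
  "hodge_star G \<omega> a b =
     (\<Sum>c\<in>UNIV. \<Sum>d\<in>UNIV. \<Sum>p\<in>UNIV. \<Sum>q\<in>UNIV.
        vol_form G a b c d * matrix_inv G $ c $ p * matrix_inv G $ d $ q * \<omega> p q) / 2"

text \<open>\<open>W\<^sup>- = (W - \<star>W)/2\<close>, the anti-self-dual part of the Weyl tensor as a two-form in its first two
  arguments. As \<open>W\<close> commutes with \<open>\<star>\<close>, it is also anti-self-dual in the last two.\<close>

definition weyl_minus ::
  "(4 \<Rightarrow> 'b::real_normed_vector) \<Rightarrow> ('b \<Rightarrow> real^4^4) \<Rightarrow> 'b \<Rightarrow> 4 \<Rightarrow> 4 \<Rightarrow> 4 \<Rightarrow> 4 \<Rightarrow> real" where
  "weyl_minus e G z a b c d =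
     (weyl e G z a b c d - hodge_star (G z) (\<lambda>p q. weyl e G z p q c d) a b) / 2"

text \<open>The frame \<open>\<partial>/\<partial>x\<^sup>1, \<partial>/\<partial>y\<^sup>1, \<partial>/\<partial>x\<^sup>2, \<partial>/\<partial>y\<^sup>2\<close>, positive for the complex orientation.\<close>

definition real_frame :: "4 \<Rightarrow> complex^2" where
  "real_frame a = vector [axis 1 1, axis 1 \<i>, axis 2 1, axis 2 \<i>] $ a"

text \<open>The real tangent vector with complex components \<open>v\<close> is \<open>\<Sum>k. v\<^sup>k \<partial>/\<partial>z\<^sup>k\<close> plus its conjugate,
  so the metric whose complex bilinear extension has components \<open>g\<^bsub>k l-bar\<^esub>\<close> is
  \<open>2 Re (\<Sum>k l. g\<^bsub>k l-bar\<^esub> v\<^sup>k \<bar>w\<^sup>l)\<close>.\<close>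

definition riem_metric :: "(complex^2 \<Rightarrow> complex^2^2) \<Rightarrow> complex^2 \<Rightarrow> real^4^4" where
  "riem_metric h z = (\<chi> a b. 2 * Re (herm (h z) (real_frame a) (real_frame b)))"

definition self_dual ::
  "('a, 2) chart set \<Rightarrow> (('a, 2) chart \<Rightarrow> complex^2 \<Rightarrow> complex^2^2) \<Rightarrow> bool" where
  "self_dual A g \<longleftrightarrow>
     (\<forall>c\<in>A. \<forall>p\<in>fst c. \<forall>a b i j. weyl_minus real_frame (riem_metric (g c)) (snd c p) a b i j = 0)"

end

theory Submission
  imports Defs
begin

text \<open>
  The argument takes place at one point of one chart. On a complex surface with its complex
  orientation, the complexified anti-self-dual bivectors form the three-dimensional space of
  primitive \<open>(1,1)\<close>-bivectors, and the null vectors of that space are exactly the products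
  \<open>X \<and> \<bar>Y\<close> of orthogonal \<open>(1,0)\<close>-vectors \<open>X\<close> and \<open>Y\<close>. A quadratic form that vanishes on
  the null cone is a multiple of the metric; the quadratic form of the Weyl tensor on anti-self-dual
  bivectors has trace zero, and the Weyl tensor does not mix the two types of bivectors. So
  \<open>W\<^sup>- = 0\<close> follows from \<open>W(X, \<bar>Y, X, \<bar>Y) = 0\<close> for all orthogonal \<open>X\<close> and \<open>Y\<close>
  (\<open>anti_self_dual_part_zero\<close>; \<open>hodge_star_self_dual\<close> turns its frame version into the
  statement about the Hodge star).

  As \<open>X\<close> and \<open>\<bar>Y\<close> span an isotropic plane, the Ricci and scalar terms of the Weyl tensor
  drop out and \<open>W(X, \<bar>Y, X, \<bar>Y)\<close> is the Riemann tensor \<open>Rm(X, \<bar>Y, X, \<bar>Y)\<close>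
  (\<open>quadlin_weyl\<close>). For the complexified Christoffel symbols of constant coefficient fields the
  latter is
  \<open>\<partial>\<^bsub>X\<^esub> \<partial>\<^bsub>\<bar>Y\<^esub> g(X, \<bar>Y) + \<langle>\<Gamma>(X, \<bar>Y), \<Gamma>(X, \<bar>Y)\<rangle> - \<langle>\<Gamma>(X, X), \<Gamma>(\<bar>Y, \<bar>Y)\<rangle>\<close>.
  The first and the last term make up minus the Chern curvature \<open>R(X, \<bar>Y, X, \<bar>Y)\<close>. The middle
  term is what the torsion of the Chern connection contributes; it vanishes in dimension two, because
  the covector \<open>\<Gamma>(X, \<bar>Y)\<close> annihilates the maximal isotropic plane spanned by \<open>X\<close> and \<open>\<bar>Y\<close>,
  hence is dual to a vector in this plane and null (\<open>mixed_christoffel_null\<close>, \<open>riem_eq_chern\<close>).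

  Constant mixed curvature \<open>C\<close> says \<open>\<beta> R(X, \<bar>X, X, \<bar>X) = g(X, \<bar>X) (C g(X, \<bar>X) - \<alpha> Ric(X, \<bar>X))\<close>
  for all \<open>X\<close>. Both sides are polynomials of bidegree \<open>(2, 2)\<close> in \<open>X\<close> and \<open>\<bar>X\<close>, so the identity
  persists when \<open>\<bar>X\<close> is replaced by an independent \<open>\<bar>Y\<close> (\<open>hermitian_polarization\<close>), and the factor
  \<open>g(X, \<bar>Y)\<close> then gives \<open>R(X, \<bar>Y, X, \<bar>Y) = 0\<close> for orthogonal \<open>X\<close> and \<open>Y\<close>. Only the
  sesquilinearity of \<open>Ric\<close> enters, which all four Ricci curvatures share.
\<close>

section \<open>Calculus of partial derivatives\<close>

lemma pd_eqI: "(f has_derivative f') (at z) \<Longrightarrow> pd v f z = f' v"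
  unfolding pd_def using frechet_derivative_at by metis

text \<open>\<open>pd\<close> is defined by a choice of derivative, so it depends on the germ of a function at a point;
  this is what permits rewriting inside iterated derivatives.\<close>

lemma pd_cong_open:
  assumes "open S" "z \<in> S" "\<And>w. w \<in> S \<Longrightarrow> f w = g w" "f differentiable at z"
  shows "pd v f z = pd v g z"
  unfolding pd_def using frechet_derivative_transform_within_open[OF assms(4,1,2)] assms(3) by metis

lemma differentiable_cong_open:
  assumes "open S" "z \<in> S" "\<And>w. w \<in> S \<Longrightarrow> f w = g w" "f differentiable at z"
  shows "g differentiable at z"
  using assms unfolding differentiable_def by (meson has_derivative_transform_within_open)

lemma pd_add:
  assumes "f differentiable at z" "g differentiable at z"
  shows "pd v (\<lambda>w. f w + g w) z = pd v f z + pd v g z"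
  using pd_eqI[OF has_derivative_add[OF assms[unfolded frechet_derivative_works]]]
  by (simp add: pd_def)

lemma pd_diff:
  assumes "f differentiable at z" "g differentiable at z"
  shows "pd v (\<lambda>w. f w - g w) z = pd v f z - pd v g z"
  using pd_eqI[OF has_derivative_diff[OF assms[unfolded frechet_derivative_works]]]
  by (simp add: pd_def)

lemma pd_sum:
  assumes "\<And>i. i \<in> I \<Longrightarrow> f i differentiable at z"
  shows "pd v (\<lambda>w. \<Sum>i\<in>I. f i w) z = (\<Sum>i\<in>I. pd v (f i) z)"
  using pd_eqI[OF has_derivative_sum[of I f "\<lambda>i. frechet_derivative (f i) (at z)" "at z"]] assms
  by (simp add: pd_def frechet_derivative_works)

lemma pd_mult:
  fixes f g :: "'b::real_normed_vector \<Rightarrow> 'c::real_normed_algebra"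
  assumes "f differentiable at z" "g differentiable at z"
  shows "pd v (\<lambda>w. f w * g w) z = f z * pd v g z + pd v f z * g z"
  using pd_eqI[OF has_derivative_mult[OF assms[unfolded frechet_derivative_works]]]
  by (simp add: pd_def)

lemma pd_bounded_linear:
  assumes "bounded_linear L" "f differentiable at z"
  shows "pd v (\<lambda>w. L (f w)) z = L (pd v f z)"
  using pd_eqI[OF bounded_linear.has_derivative[OF assms(1) assms(2)[unfolded frechet_derivative_works]]]
  by (simp add: pd_def)

text \<open>Young's form of the symmetry of second derivatives: the mean value theorem in direction \<open>v\<close>
  turns the second difference into \<open>s\<close> times an increment of \<open>pd v f\<close>, which its differentiability
  at \<open>z\<close> evaluates up to \<open>o(s)\<close>. The left-hand side is symmetric in \<open>u\<close> and \<open>v\<close>.\<close>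

lemma second_difference_tendsto:
  fixes f :: "'b::real_normed_vector \<Rightarrow> real"
  assumes S: "open S" "z \<in> S" and f: "\<And>w. w \<in> S \<Longrightarrow> f differentiable at w"
    and fv: "pd v f differentiable at z"
  shows "((\<lambda>s. (f (z + s *\<^sub>R u + s *\<^sub>R v) - f (z + s *\<^sub>R u) - f (z + s *\<^sub>R v) + f z) / s\<^sup>2)
    \<longlongrightarrow> pd u (pd v f) z) (at_right 0)"
proof -
  define L where "L = frechet_derivative (pd v f) (at z)"
  \<comment> \<open>The summand 1 keeps \<open>N\<close> positive if \<open>u = v = 0\<close> and makes the bound on the increments strict.\<close>
  define N where "N = norm u + 2 * norm v + 1"
  have N: "N > 0" unfolding N_def by (smt (verit) norm_ge_zero)
  have L: "(pd v f has_derivative L) (at z)"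
    using fv unfolding L_def frechet_derivative_works .
  interpret L: bounded_linear L using L by (rule has_derivative_bounded_linear)
  let ?D = "\<lambda>s. f (z + s *\<^sub>R u + s *\<^sub>R v) - f (z + s *\<^sub>R u) - f (z + s *\<^sub>R v) + f z"
  show ?thesis
  proof (rule tendstoI)
    fix e :: real assume "e > 0"
    define \<epsilon> where "\<epsilon> = e / (2 * N)"
    have \<epsilon>: "\<epsilon> > 0" "\<epsilon> * N < e" using \<open>e > 0\<close> N by (auto simp: \<epsilon>_def)
    obtain r where r: "r > 0" "ball z r \<subseteq> S" using S openE by blast
    obtain d where d: "d > 0"
      "\<And>y. norm (y - z) < d \<Longrightarrow> norm (pd v f y - pd v f z - L (y - z)) \<le> \<epsilon> * norm (y - z)"
      using L \<epsilon>(1) unfolding has_derivative_at_alt by meson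
    define s0 where "s0 = min r d / N"
    have s0: "s0 > 0" using r d N by (simp add: s0_def)
    have "dist (?D s / s\<^sup>2) (pd u (pd v f) z) < e" if s: "0 < s" "s < s0" for s
    proof -
      have sN: "s * N < r" "s * N < d" using s N by (auto simp: s0_def field_simps)
      have small: "norm (a *\<^sub>R u + t *\<^sub>R v) \<le> a * norm u + t * norm v" if "0 \<le> a" "0 \<le> t" for a t
        using norm_triangle_ineq[of "a *\<^sub>R u" "t *\<^sub>R v"] that by simp
      have bnd: "a * norm u + t * norm v < s * N" if "0 \<le> a" "a \<le> s" "0 \<le> t" "t \<le> s" for a t
      proof -
        have "a * norm u \<le> s * norm u" "t * norm v \<le> s * norm v" "0 \<le> s * norm v"
          using that s by (auto intro: mult_right_mono)
        moreover have "s * N = s * norm u + 2 * (s * norm v) + s" by (simp add: N_def algebra_simps)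
        ultimately show ?thesis using s by linarith
      qed
      have inS: "z + a *\<^sub>R u + t *\<^sub>R v \<in> S" if "0 \<le> a" "a \<le> s" "0 \<le> t" "t \<le> s" for a t
      proof -
        have "norm (a *\<^sub>R u + t *\<^sub>R v) < r" using small[of a t] bnd[OF that] sN that by linarith
        then have "dist z (z + a *\<^sub>R u + t *\<^sub>R v) < r"
          by (metis add.assoc add_diff_cancel_left' dist_commute dist_norm)
        then show ?thesis using r by auto
      qed
      define \<phi> where "\<phi> t = f (z + s *\<^sub>R u + t *\<^sub>R v) - f (z + t *\<^sub>R v)" for t
      have der: "((\<lambda>t. f (z + a *\<^sub>R u + t *\<^sub>R v)) has_real_derivative pd v f (z + a *\<^sub>R u + t *\<^sub>R v)) (at t)"
        if "0 \<le> a" "a \<le> s" "0 \<le> t" "t \<le> s" for a t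
      proof -
        have "(f has_derivative frechet_derivative f (at (z + a *\<^sub>R u + t *\<^sub>R v))) (at (z + a *\<^sub>R u + t *\<^sub>R v))"
          using f[OF inS[OF that]] unfolding frechet_derivative_works .
        moreover have "((\<lambda>t. z + a *\<^sub>R u + t *\<^sub>R v) has_derivative (\<lambda>h. h *\<^sub>R v)) (at t)"
          by (auto intro!: derivative_eq_intros)
        ultimately have "((\<lambda>t. f (z + a *\<^sub>R u + t *\<^sub>R v)) has_derivative
            (\<lambda>h. frechet_derivative f (at (z + a *\<^sub>R u + t *\<^sub>R v)) (h *\<^sub>R v))) (at t)"
          by (rule has_derivative_compose[rotated])
        moreover have "frechet_derivative f (at (z + a *\<^sub>R u + t *\<^sub>R v)) (h *\<^sub>R v)
            = pd v f (z + a *\<^sub>R u + t *\<^sub>R v) * h" for h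
          using linear_frechet_derivative[OF f[OF inS[OF that]]] by (simp add: pd_def linear_cmul)
        ultimately show ?thesis by (simp add: has_field_derivative_def)
      qed
      have "(\<phi> has_real_derivative (pd v f (z + s *\<^sub>R u + t *\<^sub>R v) - pd v f (z + t *\<^sub>R v))) (at t)"
        if "0 \<le> t" "t \<le> s" for t
        unfolding \<phi>_def using DERIV_diff[OF der[of s t] der[of 0 t]] that s by simp
      \<comment> \<open>The mean value theorem is applied once, in direction \<open>v\<close>; direction \<open>u\<close> is left to the differentiability of \<open>pd v f\<close>.\<close>
      from MVT2[OF s(1) this] obtain t where t: "0 < t" "t < s"
        and eq: "\<phi> s - \<phi> 0 = s * (pd v f (z + s *\<^sub>R u + t *\<^sub>R v) - pd v f (z + t *\<^sub>R v))" by auto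
      have est: "\<bar>pd v f (z + a *\<^sub>R u + t *\<^sub>R v) - pd v f z - (a * L u + t * L v)\<bar> \<le> \<epsilon> * (a * norm u + t * norm v)"
        if "0 \<le> a" "a \<le> s" for a
      proof -
        have n: "norm (a *\<^sub>R u + t *\<^sub>R v) < d" using small[of a t] bnd[of a t] sN that t by linarith
        have "\<bar>pd v f (z + a *\<^sub>R u + t *\<^sub>R v) - pd v f z - (a * L u + t * L v)\<bar> \<le> \<epsilon> * norm (a *\<^sub>R u + t *\<^sub>R v)"
          using d(2)[of "z + (a *\<^sub>R u + t *\<^sub>R v)"] n by (simp add: L.add L.scaleR add.assoc)
        also have "\<dots> \<le> \<epsilon> * (a * norm u + t * norm v)"
          using small[of a t] that t \<epsilon> by (intro mult_left_mono) auto
        finally show ?thesis .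
      qed
      have "\<bar>(\<phi> s - \<phi> 0) / s - s * L u\<bar> \<le> \<epsilon> * (s * norm u + 2 * (t * norm v))"
      proof -
        have "(\<phi> s - \<phi> 0) / s = pd v f (z + s *\<^sub>R u + t *\<^sub>R v) - pd v f (z + t *\<^sub>R v)"
          using eq s by simp
        moreover have "\<epsilon> * (s * norm u + 2 * (t * norm v)) = \<epsilon> * (s * norm u + t * norm v) + \<epsilon> * (t * norm v)"
          by (simp add: algebra_simps)
        ultimately show ?thesis using est[of s] est[of 0] s by simp
      qed
      also have "\<dots> \<le> \<epsilon> * (s * N)"
      proof (rule mult_left_mono)
        have "t * norm v \<le> s * norm v" using t by (intro mult_right_mono) auto
        moreover have "s * N = s * norm u + 2 * (s * norm v) + s" by (simp add: N_def algebra_simps)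
        ultimately show "s * norm u + 2 * (t * norm v) \<le> s * N" using s by linarith
      qed (use \<epsilon> in simp)
      also have "(\<phi> s - \<phi> 0) / s - s * L u = s * (?D s / s\<^sup>2 - L u)"
        using s by (simp add: \<phi>_def field_simps power2_eq_square)
      finally have "s * \<bar>?D s / s\<^sup>2 - L u\<bar> \<le> s * (\<epsilon> * N)"
        using s by (simp add: abs_mult mult.left_commute)
      then have "\<bar>?D s / s\<^sup>2 - L u\<bar> \<le> \<epsilon> * N" using s by simp
      then show ?thesis using \<epsilon>(2) by (simp add: dist_real_def L_def pd_def)
    qed
    then show "\<forall>\<^sub>F s in at_right 0. dist (?D s / s\<^sup>2) (pd u (pd v f) z) < e"
      using s0 unfolding eventually_at_right_field by blast
  qed
qed

lemma pd_commute:
  fixes f :: "'b::real_normed_vector \<Rightarrow> real"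
  assumes "open S" "z \<in> S" "\<And>w. w \<in> S \<Longrightarrow> f differentiable at w"
    and "pd u f differentiable at z" "pd v f differentiable at z"
  shows "pd u (pd v f) z = pd v (pd u f) z"
proof -
  have "((\<lambda>s. (f (z + s *\<^sub>R u + s *\<^sub>R v) - f (z + s *\<^sub>R u) - f (z + s *\<^sub>R v) + f z) / s\<^sup>2)
    \<longlongrightarrow> pd v (pd u f) z) (at_right 0)"
    using second_difference_tendsto[OF assms(1-4), of v] by (simp add: algebra_simps)
  then show ?thesis
    using second_difference_tendsto[OF assms(1-3,5), of u] tendsto_unique by force
qed

lemma smooth_fun_on_differentiable:
  assumes "smooth_fun_on S f" "open S" "z \<in> S"
  shows "f differentiable at z" "pd v f differentiable at z"
proof -
  have "foldr pd [] f differentiable_on S" "foldr pd [v] f differentiable_on S"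
    using assms(1) unfolding smooth_fun_on_def by blast+
  then show "f differentiable at z" "pd v f differentiable at z"
    using assms(2,3) by (simp_all add: differentiable_on_eq_differentiable_at)
qed

lemma differentiable_det:
  fixes B :: "'b::real_normed_vector \<Rightarrow> real^'m^'m"
  assumes "\<And>i j. (\<lambda>w. B w $ i $ j) differentiable at z"
  shows "(\<lambda>w. det (B w)) differentiable at z"
proof -
  have "((\<lambda>w. B w $ i $ j) has_derivative frechet_derivative (\<lambda>w. B w $ i $ j) (at z)) (at z)" for i j
    using assms unfolding frechet_derivative_works .
  note d = has_derivative_prod[OF this]
  show ?thesis unfolding det_def
    by (intro differentiable_sum ballI differentiable_mult differentiable_const)
      (auto intro: differentiableI[OF d] simp: finite_permutations)
qed

lemma matrix_inv_mult:
  fixes B :: "'a::field^'m^'m"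
  assumes "invertible B"
  shows "matrix_inv B ** B = mat 1" "B ** matrix_inv B = mat 1"
  using someI_ex[OF assms[unfolded invertible_def]] unfolding matrix_inv_def by auto

text \<open>Cramer's rule exhibits the entries of the inverse as quotients of polynomials in the entries,
  which makes their differentiability evident.\<close>

lemma matrix_inv_cramer:
  fixes B :: "real^'m^'m"
  assumes "invertible B"
  shows "matrix_inv B $ a $ b = det (\<chi> i j. if j = a then axis b 1 $ i else B $ i $ j) / det B"
proof -
  have "B *v column b (matrix_inv B) = axis b 1"
    using matrix_inv_mult(2)[OF assms]
    by (simp add: vec_eq_iff matrix_vector_mult_def matrix_matrix_mult_def column_def mat_def axis_def)
  then have "column b (matrix_inv B) = (\<chi> k. det (\<chi> i j. if j = k then axis b 1 $ i else B $ i $ j) / det B)"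
    using cramer[of B] assms unfolding invertible_det_nz by blast
  then show ?thesis by (simp add: vec_eq_iff column_def)
qed

lemma differentiable_matrix_inv:
  fixes B :: "'b::real_normed_vector \<Rightarrow> real^'m^'m"
  assumes "open S" "z \<in> S" "\<And>w. w \<in> S \<Longrightarrow> invertible (B w)"
    and B: "\<And>i j. (\<lambda>w. B w $ i $ j) differentiable at z"
  shows "(\<lambda>w. matrix_inv (B w) $ a $ b) differentiable at z"
proof -
  have "(\<lambda>w. det (\<chi> i j. if j = a then axis b 1 $ i else B w $ i $ j) / det (B w)) differentiable at z"
  proof (intro differentiable_divide differentiable_det)
    show "(\<lambda>w. (\<chi> i j. if j = a then axis b 1 $ i else B w $ i $ j) $ i $ j) differentiable at z" for i j
      using B by (cases "j = a") auto
    show "det (B z) \<noteq> 0" using assms(2,3) invertible_det_nz by blast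
  qed (rule B)
  then show ?thesis
    by (rule differentiable_cong_open[OF assms(1,2), rotated]) (simp add: matrix_inv_cramer assms(3))
qed

section \<open>The Riemann tensor in coordinates\<close>

text \<open>The Christoffel symbols of the first kind \<open>\<Gamma>\<^bsub>dbc\<^esub>\<close>, with the lowered index first.\<close>

definition christoffel_low ::
  "('m::finite \<Rightarrow> 'b::real_normed_vector) \<Rightarrow> ('b \<Rightarrow> real^'m^'m) \<Rightarrow> 'm \<Rightarrow> 'm \<Rightarrow> 'm \<Rightarrow> 'b \<Rightarrow> real" where
  "christoffel_low e G d b c z =
     (pd (e b) (\<lambda>w. G w $ c $ d) z + pd (e c) (\<lambda>w. G w $ b $ d) z - pd (e d) (\<lambda>w. G w $ b $ c) z) / 2"

text \<open>The regularity needed to speak of the curvature: first derivatives everywhere on \<open>S\<close>, and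
  differentiability of these.\<close>

locale riemannian_coordinates =
  fixes e :: "'m::finite \<Rightarrow> 'b::real_normed_vector" and G :: "'b \<Rightarrow> real^'m^'m" and S :: "'b set"
  assumes open_S: "open S"
    and metric_sym: "\<And>w a b. w \<in> S \<Longrightarrow> G w $ a $ b = G w $ b $ a"
    and metric_inv: "\<And>w. w \<in> S \<Longrightarrow> invertible (G w)"
    and diff1: "\<And>w a b. w \<in> S \<Longrightarrow> (\<lambda>w. G w $ a $ b) differentiable at w"
    and diff2: "\<And>w a b c. w \<in> S \<Longrightarrow> pd (e c) (\<lambda>w. G w $ a $ b) differentiable at w"
begin

abbreviation "Gi w \<equiv> matrix_inv (G w)"

abbreviation "\<Gamma> \<equiv> christoffel_low e G"

abbreviation "D1 c a b w \<equiv> pd (e c) (\<lambda>w. G w $ a $ b) w"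

abbreviation "D2 d c a b w \<equiv> pd (e d) (pd (e c) (\<lambda>w. G w $ a $ b)) w"

lemma inverse_left: "w \<in> S \<Longrightarrow> (\<Sum>d\<in>UNIV. Gi w $ a $ d * G w $ d $ b) = (if a = b then 1 else 0)"
  using arg_cong[OF matrix_inv_mult(1)[OF metric_inv[of w]], of "\<lambda>B. B $ a $ b"] by (simp add: matrix_matrix_mult_def mat_def)

lemma inverse_right: "w \<in> S \<Longrightarrow> (\<Sum>d\<in>UNIV. G w $ a $ d * Gi w $ d $ b) = (if a = b then 1 else 0)"
  using arg_cong[OF matrix_inv_mult(2)[OF metric_inv[of w]], of "\<lambda>B. B $ a $ b"] by (simp add: matrix_matrix_mult_def mat_def)

lemma inverse_sym:
  assumes w: "w \<in> S"
  shows "Gi w $ a $ b = Gi w $ b $ a"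
proof -
  have "transpose (G w) = G w" using metric_sym[OF w] by (simp add: transpose_def vec_eq_iff)
  then have "transpose (Gi w) ** G w = transpose (G w ** Gi w)" by (simp add: matrix_transpose_mul)
  then have "transpose (Gi w) ** G w = mat 1" by (simp add: matrix_inv_mult[OF metric_inv[OF w]])
  then have "transpose (Gi w) ** (G w ** Gi w) = Gi w" by (simp add: matrix_mul_assoc)
  then have "transpose (Gi w) = Gi w" by (simp add: matrix_inv_mult[OF metric_inv[OF w]])
  then have "transpose (Gi w) $ b $ a = Gi w $ b $ a" by simp
  then show ?thesis by (simp add: transpose_def)
qed

lemma christoffel_raise: "christoffel e G a b c w = (\<Sum>d\<in>UNIV. Gi w $ a $ d * \<Gamma> d b c w)"
  unfolding christoffel_def christoffel_low_def sum_divide_distrib by simp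

lemma christoffel_lower:
  assumes w: "w \<in> S"
  shows "(\<Sum>f\<in>UNIV. G w $ a $ f * christoffel e G f b c w) = \<Gamma> a b c w"
proof -
  have "(\<Sum>f\<in>UNIV. G w $ a $ f * christoffel e G f b c w)
      = (\<Sum>d\<in>UNIV. (\<Sum>f\<in>UNIV. G w $ a $ f * Gi w $ f $ d) * \<Gamma> d b c w)"
    unfolding christoffel_raise sum_distrib_left sum_distrib_right
    by (subst sum.swap) (simp add: mult.assoc)
  also have "\<dots> = \<Gamma> a b c w" by (simp add: inverse_right[OF w] if_distrib[of "\<lambda>x. x * _"] cong: if_cong)
  finally show ?thesis .
qed

lemma D1_sym: "w \<in> S \<Longrightarrow> D1 c a b w = D1 c b a w"
  by (rule pd_cong_open[OF open_S]) (auto intro: metric_sym diff1)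

lemma D2_sym: "w \<in> S \<Longrightarrow> D2 d c a b w = D2 d c b a w"
  by (rule pd_cong_open[OF open_S]) (auto intro: D1_sym diff2)

lemma D2_commute: "w \<in> S \<Longrightarrow> D2 d c a b w = D2 c d a b w"
  by (rule pd_commute[OF open_S]) (auto intro: diff1 diff2)

lemma D2_swap: "w \<in> S \<Longrightarrow> D2 d c a b w = D2 c d b a w"
  using D2_sym[of w c d a b] D2_commute[of w d c a b] by simp

lemma christoffel_low_sym: "w \<in> S \<Longrightarrow> \<Gamma> a b c w = \<Gamma> a c b w"
  unfolding christoffel_low_def using D1_sym[of w a b c] by simp

text \<open>Metric compatibility of the Levi-Civita connection.\<close>

lemma D1_christoffel: "w \<in> S \<Longrightarrow> D1 c a b w = \<Gamma> a c b w + \<Gamma> b c a w"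
  unfolding christoffel_low_def using D1_sym[of w] by (simp add: field_simps)

lemma differentiable_christoffel_low:
  assumes "w \<in> S" shows "(\<lambda>w. \<Gamma> a b c w) differentiable at w"
proof -
  have "(\<lambda>w. (D1 b c a w + D1 c b a w - D1 a b c w) * (1 / 2)) differentiable at w"
    by (intro differentiable_mult differentiable_add differentiable_diff differentiable_const diff2 assms)
  then show ?thesis by (simp add: christoffel_low_def)
qed

lemma differentiable_christoffel:
  assumes "w \<in> S" shows "(\<lambda>w. christoffel e G a b c w) differentiable at w"
  unfolding christoffel_raise
  by (intro differentiable_sum ballI differentiable_mult differentiable_christoffel_low assms finite
      differentiable_matrix_inv[OF open_S assms metric_inv diff1[OF assms]])

lemma pd_christoffel_low:
  assumes "w \<in> S" shows "pd (e d) (\<lambda>w. \<Gamma> a b c w) w = (D2 d b c a w + D2 d c b a w - D2 d a b c w) / 2"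
proof -
  have "pd (e d) (\<lambda>w. (D1 b c a w + D1 c b a w - D1 a b c w) / 2) w
     = pd (e d) (\<lambda>w. D1 b c a w + D1 c b a w - D1 a b c w) w / 2"
    by (rule pd_bounded_linear[OF bounded_linear_divide])
      (intro differentiable_add differentiable_diff diff2 assms)
  then show ?thesis unfolding christoffel_low_def
    by (simp add: pd_add pd_diff diff2 assms)
qed

text \<open>Differentiating \<open>G \<Gamma> = \<Gamma>\<^bsub>low\<^esub>\<close> by the Leibniz rule, rather than \<open>\<Gamma> = G\<inverse> \<Gamma>\<^bsub>low\<^esub>\<close>,
  avoids any formula for the derivative of the inverse matrix.\<close>

lemma lower_pd_christoffel:
  assumes w: "w \<in> S"
  shows "(\<Sum>f\<in>UNIV. G w $ a $ f * pd (e c) (christoffel e G f d b) w)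
    = (D2 c d b a w + D2 c b d a w - D2 c a d b w) / 2
      - (\<Sum>f\<in>UNIV. (\<Gamma> a c f w + \<Gamma> f c a w) * christoffel e G f d b w)"
proof -
  note df = differentiable_christoffel[OF w] diff1[OF w]
  have "pd (e c) (\<lambda>w. \<Gamma> a d b w) w = pd (e c) (\<lambda>w. \<Sum>f\<in>UNIV. G w $ a $ f * christoffel e G f d b w) w"
    by (rule pd_cong_open[OF open_S w]) (auto simp: christoffel_lower differentiable_christoffel_low w)
  also have "\<dots> = (\<Sum>f\<in>UNIV. G w $ a $ f * pd (e c) (christoffel e G f d b) w
      + D1 c a f w * christoffel e G f d b w)"
    by (subst pd_sum) (auto intro!: sum.cong differentiable_mult pd_mult df simp: df[simplified])
  finally have "pd (e c) (\<lambda>w. \<Gamma> a d b w) w = (\<Sum>f\<in>UNIV. G w $ a $ f * pd (e c) (christoffel e G f d b) w)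
      + (\<Sum>f\<in>UNIV. (\<Gamma> a c f w + \<Gamma> f c a w) * christoffel e G f d b w)"
    by (simp only: sum.distrib D1_christoffel[OF w])
  then show ?thesis unfolding pd_christoffel_low[OF w] by linarith
qed

text \<open>The inner product, in the inverse metric, of the covectors \<open>\<Gamma>(\<partial>\<^sub>a, \<partial>\<^sub>b)\<close> and \<open>\<Gamma>(\<partial>\<^sub>c, \<partial>\<^sub>d)\<close>.\<close>

definition \<Gamma>\<Gamma> :: "'m \<Rightarrow> 'm \<Rightarrow> 'm \<Rightarrow> 'm \<Rightarrow> 'b \<Rightarrow> real" where
  "\<Gamma>\<Gamma> a b c d w = (\<Sum>p\<in>UNIV. \<Sum>q\<in>UNIV. Gi w $ p $ q * \<Gamma> p a b w * \<Gamma> q c d w)"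

lemma \<Gamma>\<Gamma>_swap: "w \<in> S \<Longrightarrow> \<Gamma>\<Gamma> c d a b w = \<Gamma>\<Gamma> a b c d w"
  unfolding \<Gamma>\<Gamma>_def by (subst sum.swap) (simp add: inverse_sym ac_simps)

lemma \<Gamma>\<Gamma>_sym: "w \<in> S \<Longrightarrow> \<Gamma>\<Gamma> b a c d w = \<Gamma>\<Gamma> a b c d w" "w \<in> S \<Longrightarrow> \<Gamma>\<Gamma> a b d c w = \<Gamma>\<Gamma> a b c d w"
  unfolding \<Gamma>\<Gamma>_def by (simp_all only: christoffel_low_sym[of w _ a b] christoffel_low_sym[of w _ c d])

lemma \<Gamma>\<Gamma>_christoffel: "(\<Sum>h\<in>UNIV. \<Gamma> h a b w * christoffel e G h c d w) = \<Gamma>\<Gamma> a b c d w"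
  unfolding \<Gamma>\<Gamma>_def christoffel_raise sum_distrib_left by (simp add: ac_simps)

text \<open>In the lowered tensor the terms \<open>(\<partial>G) \<Gamma>\<close> from the Leibniz rule are rewritten by metric
  compatibility; one half of the result cancels the products \<open>\<Gamma> \<Gamma>\<close>. This is the form in which the symmetries of
  the tensor are visible and in which complex vectors can be inserted.\<close>

theorem riem_formula:
  assumes w: "w \<in> S"
  shows "riem e G w a b c d =
     (D2 c b d a w - D2 c a d b w - D2 d b c a w + D2 d a c b w) / 2
     + \<Gamma>\<Gamma> d a c b w - \<Gamma>\<Gamma> c a d b w"
proof -
  let ?C = "\<lambda>f b c. christoffel e G f b c w"
  have low: "(\<Sum>f\<in>UNIV. G w $ a $ f * (\<Sum>h\<in>UNIV. ?C f x h * ?C h y b)) = (\<Sum>h\<in>UNIV. \<Gamma> a x h w * ?C h y b)"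
    for x y
    unfolding sum_distrib_left
    by (subst sum.swap) (simp add: christoffel_lower[OF w, symmetric] sum_distrib_right mult.assoc)
  have "riem e G w a b c d =
      (\<Sum>f\<in>UNIV. G w $ a $ f * pd (e c) (christoffel e G f d b) w)
      - (\<Sum>f\<in>UNIV. G w $ a $ f * pd (e d) (christoffel e G f c b) w)
      + (\<Sum>h\<in>UNIV. \<Gamma> a c h w * ?C h d b) - (\<Sum>h\<in>UNIV. \<Gamma> a d h w * ?C h c b)"
    unfolding riem_def riem_up_def low[symmetric]
    by (simp add: right_diff_distrib distrib_left sum.distrib sum_subtractf)
  also have "\<dots> = (D2 c d b a w + D2 c b d a w - D2 c a d b w) / 2
       - (D2 d c b a w + D2 d b c a w - D2 d a c b w) / 2
       + \<Gamma>\<Gamma> d a c b w - \<Gamma>\<Gamma> c a d b w"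
    unfolding lower_pd_christoffel[OF w] \<Gamma>\<Gamma>_christoffel[symmetric]
    by (simp add: distrib_right sum.distrib)
  finally show ?thesis using D2_commute[OF w, of c d b a] by (simp add: field_simps)
qed

lemma riem_antisym1: "w \<in> S \<Longrightarrow> riem e G w b a c d = - riem e G w a b c d"
  unfolding riem_formula using \<Gamma>\<Gamma>_swap[of w d a c b] \<Gamma>\<Gamma>_swap[of w d b c a] by (simp add: field_simps)

lemma riem_antisym2: "w \<in> S \<Longrightarrow> riem e G w a b d c = - riem e G w a b c d"
  unfolding riem_formula by (simp add: field_simps)

lemma riem_pair:
  assumes w: "w \<in> S"
  shows "riem e G w c d a b = riem e G w a b c d"
proof -
  have "D2 a d b c w = D2 d a c b w" "D2 a c b d w = D2 c a d b w"
    "D2 b d a c w = D2 d b c a w" "D2 b c a d w = D2 c b d a w"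
    by (rule D2_swap[OF w])+
  moreover have "\<Gamma>\<Gamma> b c a d w = \<Gamma>\<Gamma> d a c b w" "\<Gamma>\<Gamma> a c b d w = \<Gamma>\<Gamma> c a d b w"
    using \<Gamma>\<Gamma>_swap[OF w, of b c a d] \<Gamma>\<Gamma>_sym(1)[OF w, of d a c b] \<Gamma>\<Gamma>_sym(2)[OF w, of a d b c]
      \<Gamma>\<Gamma>_sym(1)[OF w, of c a b d] \<Gamma>\<Gamma>_sym(2)[OF w, of c a d b] by simp_all
  ultimately show ?thesis unfolding riem_formula[OF w] by simp
qed

lemma riem_bianchi:
  assumes w: "w \<in> S"
  shows "riem e G w a b c d + riem e G w a c d b + riem e G w a d b c = 0"
proof -
  have "D2 d c b a w = D2 c d a b w" "D2 c b d a w = D2 b c a d w" "D2 d b c a w = D2 b d a c w"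
    "D2 c a d b w = D2 a c b d w" "D2 d a c b w = D2 a d b c w" "D2 b a c d w = D2 a b d c w"
    "D2 c a b d w = D2 a c d b w" "D2 d a b c w = D2 a d c b w" "D2 b a d c w = D2 a b c d w"
    by (rule D2_swap[OF w])+
  moreover have "D2 a b d c w = D2 a b c d w" "D2 a c b d w = D2 a c d b w" "D2 a d c b w = D2 a d b c w"
     "D2 b d c a w = D2 b d a c w" "D2 c d b a w = D2 c d a b w" "D2 d b a c w = D2 d b c a w" "D2 b c d a w = D2 b c a d w"
    by (rule D2_sym[OF w])+
  moreover have "\<Gamma>\<Gamma> d a c b w = \<Gamma>\<Gamma> d a b c w" "\<Gamma>\<Gamma> b a d c w = \<Gamma>\<Gamma> b a c d w" "\<Gamma>\<Gamma> c a d b w = \<Gamma>\<Gamma> c a b d w"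
    by (rule \<Gamma>\<Gamma>_sym(2)[OF w])+
  ultimately show ?thesis unfolding riem_formula[OF w] by (simp add: field_simps)
qed

lemma ricci_trace:
  assumes w: "w \<in> S"
  shows "ricci e G w b d = (\<Sum>a\<in>UNIV. \<Sum>c\<in>UNIV. Gi w $ a $ c * riem e G w c b a d)"
proof -
  have "(\<Sum>c\<in>UNIV. Gi w $ a $ c * riem e G w c b a d) = riem_up e G w a b a d" for a
  proof -
    have "(\<Sum>c\<in>UNIV. Gi w $ a $ c * riem e G w c b a d)
       = (\<Sum>f\<in>UNIV. (\<Sum>c\<in>UNIV. Gi w $ a $ c * G w $ c $ f) * riem_up e G w f b a d)"
      unfolding riem_def sum_distrib_left sum_distrib_right by (subst sum.swap) (simp add: mult.assoc)
    then show ?thesis unfolding inverse_left[OF w]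
      by (simp add: if_distrib[of "\<lambda>x. x * _"] cong: if_cong)
  qed
  then show ?thesis unfolding ricci_def by simp
qed

end

section \<open>Algebraic curvature tensors\<close>

definition curvature_like :: "('m \<Rightarrow> 'm \<Rightarrow> 'm \<Rightarrow> 'm \<Rightarrow> real) \<Rightarrow> bool" where
  "curvature_like T \<longleftrightarrow> (\<forall>a b c d. T b a c d = - T a b c d \<and> T a b d c = - T a b c d
     \<and> T c d a b = T a b c d \<and> T a b c d + T a c d b + T a d b c = 0)"

lemma curvature_likeD:
  assumes "curvature_like T"
  shows "T b a c d = - T a b c d" "T a b d c = - T a b c d" "T c d a b = T a b c d"
    "T a b c d + T a c d b + T a d b c = 0"
  using assms unfolding curvature_like_def by blast+

context riemannian_coordinates begin

lemma curvature_like_riem: "w \<in> S \<Longrightarrow> curvature_like (riem e G w)"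
  unfolding curvature_like_def
  using riem_antisym1 riem_antisym2 riem_pair riem_bianchi by blast

lemma ricci_sym:
  assumes w: "w \<in> S"
  shows "ricci e G w b d = ricci e G w d b"
  unfolding ricci_trace[OF w]
  by (subst sum.swap) (simp add: inverse_sym[OF w] riem_pair[OF w, of _ b _ d])

lemma curvature_like_weyl:
  assumes w: "w \<in> S"
  shows "curvature_like (weyl e G w)"
proof -
  note R = curvature_likeD[OF curvature_like_riem[OF w]]
  let ?n = "1 / (real CARD('m) - 2)" and ?s = "scalar_curv e G w / ((real CARD('m) - 1) * (real CARD('m) - 2))"
  have W: "weyl e G w a b c d = riem e G w a b c d
     - ?n * (G w $ a $ c * ricci e G w b d - G w $ a $ d * ricci e G w b c
        - G w $ b $ c * ricci e G w a d + G w $ b $ d * ricci e G w a c)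
     + ?s * (G w $ a $ c * G w $ b $ d - G w $ a $ d * G w $ b $ c)" for a b c d
    unfolding weyl_def by simp
  show ?thesis unfolding curvature_like_def
  proof (intro allI conjI)
    fix a b c d
    show "weyl e G w b a c d = - weyl e G w a b c d" unfolding W using R(1)[of b a c d]
      by (simp add: algebra_simps)
    show "weyl e G w a b d c = - weyl e G w a b c d" unfolding W using R(2)[of a b d c]
      by (simp add: algebra_simps)
    show "weyl e G w c d a b = weyl e G w a b c d"
      unfolding W using R(3)[of c d a b] metric_sym[OF w, of c] metric_sym[OF w, of d] ricci_sym[OF w, of c] ricci_sym[OF w, of d]
      by (simp add: algebra_simps)
    show "weyl e G w a b c d + weyl e G w a c d b + weyl e G w a d b c = 0"
      unfolding W using R(4)[of a b c d] metric_sym[OF w, of d b] metric_sym[OF w, of d c] metric_sym[OF w, of c b]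
        ricci_sym[OF w, of d b] ricci_sym[OF w, of d c] ricci_sym[OF w, of c b]
      by (simp add: algebra_simps)
  qed
qed

text \<open>The coefficients in the definition of the Weyl tensor are chosen to make this trace vanish; the two
  excluded dimensions are those where their denominators are zero.\<close>

lemma weyl_trace_free:
  assumes w: "w \<in> S" and n: "CARD('m) \<noteq> 1" "CARD('m) \<noteq> 2"
  shows "(\<Sum>a\<in>UNIV. \<Sum>c\<in>UNIV. Gi w $ a $ c * weyl e G w a b c d) = 0"
proof -
  let ?n = "real CARD('m)" and ?R = "ricci e G w"
  have ric: "(\<Sum>a\<in>UNIV. \<Sum>c\<in>UNIV. Gi w $ a $ c * riem e G w a b c d) = ?R b d"
    unfolding ricci_trace[OF w] by (subst sum.swap) (simp add: inverse_sym[OF w])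
  have sc: "(\<Sum>a\<in>UNIV. \<Sum>c\<in>UNIV. Gi w $ a $ c * ?R a c) = scalar_curv e G w"
    unfolding scalar_curv_def ..
  have tr: "(\<Sum>a\<in>UNIV. \<Sum>c\<in>UNIV. Gi w $ a $ c * G w $ a $ c) = ?n"
    using inverse_left[OF w] by (simp add: metric_sym[OF w] inverse_sym[OF w])
  have con1: "(\<Sum>a\<in>UNIV. \<Sum>c\<in>UNIV. Gi w $ a $ c * (G w $ a $ d * f c)) = f d" for d and f :: "'m \<Rightarrow> real"
  proof -
    have "(\<Sum>a\<in>UNIV. \<Sum>c\<in>UNIV. Gi w $ a $ c * (G w $ a $ d * f c))
       = (\<Sum>c\<in>UNIV. (\<Sum>a\<in>UNIV. Gi w $ c $ a * G w $ a $ d) * f c)"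
      unfolding sum_distrib_right by (subst sum.swap) (simp add: inverse_sym[OF w] mult.assoc)
    then show ?thesis unfolding inverse_left[OF w]
      by (simp add: if_distrib[of "\<lambda>x. x * _"] cong: if_cong)
  qed
  have con2: "(\<Sum>a\<in>UNIV. \<Sum>c\<in>UNIV. Gi w $ a $ c * (G w $ b $ c * f a)) = f b" for b and f :: "'m \<Rightarrow> real"
    using con1[of b f] by (subst sum.swap) (simp add: inverse_sym[OF w] metric_sym[OF w, of b])
  have "(\<Sum>a\<in>UNIV. \<Sum>c\<in>UNIV. Gi w $ a $ c * weyl e G w a b c d)
    = (\<Sum>a\<in>UNIV. \<Sum>c\<in>UNIV. Gi w $ a $ c * riem e G w a b c d)
      - (1 / (?n - 2)) * ((\<Sum>a\<in>UNIV. \<Sum>c\<in>UNIV. Gi w $ a $ c * G w $ a $ c) * ?R b d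
        - (\<Sum>a\<in>UNIV. \<Sum>c\<in>UNIV. Gi w $ a $ c * (G w $ a $ d * ?R b c))
        - (\<Sum>a\<in>UNIV. \<Sum>c\<in>UNIV. Gi w $ a $ c * (G w $ b $ c * ?R a d))
        + G w $ b $ d * (\<Sum>a\<in>UNIV. \<Sum>c\<in>UNIV. Gi w $ a $ c * ?R a c))
      + (scalar_curv e G w / ((?n - 1) * (?n - 2))) *
        ((\<Sum>a\<in>UNIV. \<Sum>c\<in>UNIV. Gi w $ a $ c * G w $ a $ c) * G w $ b $ d
         - (\<Sum>a\<in>UNIV. \<Sum>c\<in>UNIV. Gi w $ a $ c * (G w $ a $ d * G w $ b $ c)))"
    unfolding weyl_def sum_distrib_left sum_distrib_right sum_subtractf[symmetric] sum.distrib[symmetric]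
    by (intro sum.cong refl) (simp add: algebra_simps add_divide_distrib diff_divide_distrib)
  also have "\<dots> = ?R b d - (1 / (?n - 2)) * ((?n - 2) * ?R b d + G w $ b $ d * scalar_curv e G w)
     + (scalar_curv e G w / ((?n - 1) * (?n - 2))) * ((?n - 1) * G w $ b $ d)"
    unfolding ric sc tr con1 con2[of b "\<lambda>a. ?R a d"] by (simp add: algebra_simps)
  also have "\<dots> = 0"
  proof -
    have "r - (1 / q) * (q * r + x * t) + (t / (p * q)) * (p * x) = 0" if "p \<noteq> 0" "q \<noteq> 0" for p q r x t :: real
      using that by (simp add: field_simps)
    then show ?thesis by this (use n in simp_all)
  qed
  finally show ?thesis .
qed

end

section \<open>Complex multilinear extension\<close>

definition bilin :: "('m::finite \<Rightarrow> 'm \<Rightarrow> real) \<Rightarrow> ('m \<Rightarrow> complex) \<Rightarrow> ('m \<Rightarrow> complex) \<Rightarrow> complex" where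
  "bilin B u v = (\<Sum>a\<in>UNIV. \<Sum>b\<in>UNIV. of_real (B a b) * u a * v b)"

definition quadlin ::
  "('m::finite \<Rightarrow> 'm \<Rightarrow> 'm \<Rightarrow> 'm \<Rightarrow> real) \<Rightarrow> ('m \<Rightarrow> complex) \<Rightarrow> ('m \<Rightarrow> complex) \<Rightarrow> ('m \<Rightarrow> complex) \<Rightarrow> ('m \<Rightarrow> complex)
    \<Rightarrow> complex" where
  "quadlin T u v w x = (\<Sum>a\<in>UNIV. \<Sum>b\<in>UNIV. \<Sum>c\<in>UNIV. \<Sum>d\<in>UNIV.
     of_real (T a b c d) * u a * v b * w c * x d)"

lemma bilin_swap: "bilin (\<lambda>a b. B b a) u v = bilin B v u"
  unfolding bilin_def by (subst sum.swap) (simp add: ac_simps)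

lemma quadlin_add: "quadlin (\<lambda>a b c d. T a b c d + U a b c d) u v w x = quadlin T u v w x + quadlin U u v w x"
  by (simp add: quadlin_def distrib_right sum.distrib)

lemma quadlin_diff: "quadlin (\<lambda>a b c d. T a b c d - U a b c d) u v w x = quadlin T u v w x - quadlin U u v w x"
  by (simp add: quadlin_def left_diff_distrib sum_subtractf)

lemma quadlin_scale: "quadlin (\<lambda>a b c d. k * T a b c d) u v w x = of_real k * quadlin T u v w x"
  by (simp add: quadlin_def sum_distrib_left mult.assoc)

lemma quadlin_sum:
  "quadlin (\<lambda>a b c d. \<Sum>i\<in>I. T i a b c d) u v w x = (\<Sum>i\<in>I. quadlin (T i) u v w x)"
proof (induction I rule: infinite_finite_induct)
  case (insert i I)
  then show ?case by (simp add: quadlin_add)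
qed (simp_all add: quadlin_def)

text \<open>As a rewrite rule the left-hand side would match any tensor, so every use gives the instance.\<close>

lemma quadlin_swaps:
  "quadlin (\<lambda>a b c d. T b a c d) u v w x = quadlin T v u w x"
  "quadlin (\<lambda>a b c d. T a c b d) u v w x = quadlin T u w v x"
  "quadlin (\<lambda>a b c d. T a b d c) u v w x = quadlin T u v x w"
proof -
  show "quadlin (\<lambda>a b c d. T b a c d) u v w x = quadlin T v u w x"
    unfolding quadlin_def by (subst sum.swap) (simp add: ac_simps)
  show "quadlin (\<lambda>a b c d. T a c b d) u v w x = quadlin T u w v x"
    unfolding quadlin_def by (rule sum.cong[OF refl], subst sum.swap, intro sum.cong refl) (simp add: ac_simps)
  show "quadlin (\<lambda>a b c d. T a b d c) u v w x = quadlin T u v x w"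
    unfolding quadlin_def
    by (rule sum.cong[OF refl], rule sum.cong[OF refl], subst sum.swap, intro sum.cong refl) (simp add: ac_simps)
qed

text \<open>The permutations of the four arguments that occur in the second-derivative and Christoffel terms of
  the Riemann tensor.\<close>

lemma quadlin_perm:
  "quadlin (\<lambda>a b c d. T c b d a) u v w x = quadlin T w v x u"
  "quadlin (\<lambda>a b c d. T c a d b) u v w x = quadlin T w u x v"
  "quadlin (\<lambda>a b c d. T d b c a) u v w x = quadlin T x v w u"
  "quadlin (\<lambda>a b c d. T d a c b) u v w x = quadlin T x u w v"
  "quadlin (\<lambda>a b c d. T b a d c) u v w x = quadlin T v u x w"
proof -
  show "quadlin (\<lambda>a b c d. T c b d a) u v w x = quadlin T w v x u"
    using quadlin_swaps(1)[of "\<lambda>b a c d. T c b d a" u v w x] quadlin_swaps(2)[of "\<lambda>b c a d. T c b d a" v u w x]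
      quadlin_swaps(3)[of "\<lambda>b c d a. T c b d a" v w u x] quadlin_swaps(1)[of "\<lambda>c b d a. T c b d a" v w x u]
    by simp
  show "quadlin (\<lambda>a b c d. T c a d b) u v w x = quadlin T w u x v"
    using quadlin_swaps(2)[of "\<lambda>a c b d. T c a d b" u v w x] quadlin_swaps(3)[of "\<lambda>a c d b. T c a d b" u w v x]
      quadlin_swaps(1)[of "\<lambda>c a d b. T c a d b" u w x v] by simp
  show "quadlin (\<lambda>a b c d. T d b c a) u v w x = quadlin T x v w u"
    using quadlin_swaps(1)[of "\<lambda>b a c d. T d b c a" u v w x] quadlin_swaps(2)[of "\<lambda>b c a d. T d b c a" v u w x]
      quadlin_swaps(3)[of "\<lambda>b c d a. T d b c a" v w u x] quadlin_swaps(2)[of "\<lambda>b d c a. T d b c a" v w x u]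
      quadlin_swaps(1)[of "\<lambda>d b c a. T d b c a" v x w u]
    by simp
  show "quadlin (\<lambda>a b c d. T d a c b) u v w x = quadlin T x u w v"
    using quadlin_swaps(3)[of "\<lambda>a b d c. T d a c b" u v w x] quadlin_swaps(2)[of "\<lambda>a d b c. T d a c b" u v x w]
      quadlin_swaps(1)[of "\<lambda>d a b c. T d a c b" u x v w] quadlin_swaps(3)[of "\<lambda>d a c b. T d a c b" x u v w]
    by simp
  show "quadlin (\<lambda>a b c d. T b a d c) u v w x = quadlin T v u x w"
    using quadlin_swaps(1)[of "\<lambda>b a c d. T b a d c" u v w x] quadlin_swaps(3)[of "\<lambda>b a d c. T b a d c" v u w x] by simp
qed

lemma quadlin_product:
  "quadlin (\<lambda>a b c d. P a b * Q c d) u v w x = bilin P u v * bilin Q w x"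
  "quadlin (\<lambda>a b c d. P a c * Q b d) u v w x = bilin P u w * bilin Q v x"
  "quadlin (\<lambda>a b c d. P a d * Q b c) u v w x = bilin P u x * bilin Q v w"
  "quadlin (\<lambda>a b c d. P b c * Q a d) u v w x = bilin P v w * bilin Q u x"
  "quadlin (\<lambda>a b c d. P b d * Q a c) u v w x = bilin P v x * bilin Q u w"
proof -
  have 1: "quadlin (\<lambda>a b c d. P a b * Q c d) u v w x = bilin P u v * bilin Q w x" for P Q u v w x
    unfolding quadlin_def bilin_def[of P] sum_distrib_right unfolding bilin_def sum_distrib_left
    by (intro sum.cong refl) (simp add: ac_simps)
  have 2: "quadlin (\<lambda>a b c d. P a c * Q b d) u v w x = bilin P u w * bilin Q v x" for P Q u v w x
    using quadlin_swaps(2)[of "\<lambda>a c b d. P a c * Q b d" u v w x] 1[of P Q] by simp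
  have 3: "quadlin (\<lambda>a b c d. P a d * Q b c) u v w x = bilin P u x * bilin Q v w" for P Q
    using quadlin_swaps(3)[of "\<lambda>a b d c. P a d * Q b c" u v w x] 2[of P Q] by simp
  show "quadlin (\<lambda>a b c d. P a b * Q c d) u v w x = bilin P u v * bilin Q w x"
    "quadlin (\<lambda>a b c d. P a c * Q b d) u v w x = bilin P u w * bilin Q v x"
    "quadlin (\<lambda>a b c d. P a d * Q b c) u v w x = bilin P u x * bilin Q v w"
    by (rule 1, rule 2, rule 3)
  show "quadlin (\<lambda>a b c d. P b c * Q a d) u v w x = bilin P v w * bilin Q u x"
    "quadlin (\<lambda>a b c d. P b d * Q a c) u v w x = bilin P v x * bilin Q u w"
    using 2[of Q P] 3[of Q P] by (simp_all add: mult.commute)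
qed

lemma quadlin_curvature_like:
  assumes "curvature_like T"
  shows "quadlin T v u w x = - quadlin T u v w x" "quadlin T u v x w = - quadlin T u v w x"
    "quadlin T w x u v = quadlin T u v w x"
    "quadlin T u v w x + quadlin T u w x v + quadlin T u x v w = 0"
proof -
  note T = curvature_likeD[OF assms]
  have neg: "quadlin (\<lambda>a b c d. - U a b c d) u v w x = - quadlin U u v w x" for U :: "'a \<Rightarrow> 'a \<Rightarrow> 'a \<Rightarrow> 'a \<Rightarrow> real"
    by (simp add: quadlin_def sum_negf)
  show "quadlin T v u w x = - quadlin T u v w x"
    unfolding quadlin_swaps(1)[of T u v w x, symmetric] neg[symmetric] by (intro arg_cong[where f="\<lambda>T. quadlin T u v w x"] ext T(1))
  show "quadlin T u v x w = - quadlin T u v w x"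
    unfolding quadlin_swaps(3)[of T u v w x, symmetric] neg[symmetric] by (intro arg_cong[where f="\<lambda>T. quadlin T u v w x"] ext T(2))
  have "quadlin (\<lambda>a b c d. T c d a b) u v w x = quadlin T w x u v"
    using quadlin_swaps(2)[of "\<lambda>a c b d. T c d a b" u v w x] quadlin_swaps(1)[of "\<lambda>c a b d. T c d a b" u w v x]
      quadlin_swaps(3)[of "\<lambda>c a d b. T c d a b" w u v x] quadlin_swaps(2)[of "\<lambda>c d a b. T c d a b" w u x v] by simp
  moreover have "(\<lambda>a b c d. T c d a b) = T" by (intro ext) (rule T(3))
  ultimately show "quadlin T w x u v = quadlin T u v w x" by simp
  have "quadlin (\<lambda>a b c d. T a c d b) u v w x = quadlin T u w x v"
    using quadlin_swaps(2)[of "\<lambda>a c b d. T a c d b" u v w x] quadlin_swaps(3)[of "\<lambda>a c d b. T a c d b" u w v x] by simp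
  moreover have "quadlin (\<lambda>a b c d. T a d b c) u v w x = quadlin T u x v w"
    using quadlin_swaps(3)[of "\<lambda>a b d c. T a d b c" u v w x] quadlin_swaps(2)[of "\<lambda>a d b c. T a d b c" u v x w] by simp
  moreover have "quadlin (\<lambda>a b c d. T a b c d + T a c d b + T a d b c) u v w x = 0"
    unfolding T(4) by (simp add: quadlin_def)
  ultimately show "quadlin T u v w x + quadlin T u w x v + quadlin T u x v w = 0"
    by (simp add: quadlin_add)
qed

text \<open>On an isotropic plane every correction term of the Weyl tensor contains a factor that is the metric
  evaluated on two vectors of the plane.\<close>

lemma quadlin_weyl:
  assumes "bilin (\<lambda>a b. G z $ a $ b) u u = 0" "bilin (\<lambda>a b. G z $ a $ b) v v = 0"
     "bilin (\<lambda>a b. G z $ a $ b) u v = 0" "bilin (\<lambda>a b. G z $ a $ b) v u = 0"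
  shows "quadlin (weyl e G z) u v u v = quadlin (riem e G z) u v u v"
proof -
  let ?n = "1 / (real CARD('a) - 2)" and ?s = "scalar_curv e G z / ((real CARD('a) - 1) * (real CARD('a) - 2))"
  have "weyl e G z = (\<lambda>a b c d. riem e G z a b c d
     - ?n * (G z $ a $ c * ricci e G z b d - G z $ a $ d * ricci e G z b c
        - G z $ b $ c * ricci e G z a d + G z $ b $ d * ricci e G z a c)
     + ?s * (G z $ a $ c * G z $ b $ d - G z $ a $ d * G z $ b $ c))"
    by (intro ext) (simp add: weyl_def)
  then show ?thesis
    by (simp only: quadlin_add quadlin_diff quadlin_scale quadlin_product[of "\<lambda>a b. G z $ a $ b"] assms) simp
qed

section \<open>The complexified Riemann tensor\<close>

text \<open>Complex linear extension of the directional derivative to complexified vectors \<open>u\<close>, given by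
  their coefficients in the frame \<open>e\<close>.\<close>

definition cpd :: "('m::finite \<Rightarrow> 'b::real_normed_vector) \<Rightarrow> ('m \<Rightarrow> complex) \<Rightarrow> ('b \<Rightarrow> complex) \<Rightarrow> 'b \<Rightarrow> complex" where
  "cpd e u F z = (\<Sum>a\<in>UNIV. u a * pd (e a) F z)"

lemma cpd_const [simp]: "cpd e u (\<lambda>w. k) z = 0"
  by (simp add: cpd_def pd_def)

lemma pd_bilin:
  assumes "\<And>a b. (\<lambda>w. B w a b) differentiable at z"
  shows "pd x (\<lambda>w. bilin (B w) u v) z = bilin (\<lambda>a b. pd x (\<lambda>w. B w a b) z) u v"
    and "(\<lambda>w. bilin (B w) u v) differentiable at z"
proof -
  have d: "((\<lambda>w. bilin (B w) u v) has_derivative (\<lambda>x. bilin (\<lambda>a b. frechet_derivative (\<lambda>w. B w a b) (at z) x) u v)) (at z)"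
    unfolding bilin_def
    by (intro has_derivative_sum has_derivative_mult_left
        bounded_linear.has_derivative[OF bounded_linear_of_real])
      (rule assms[unfolded frechet_derivative_works])
  show "pd x (\<lambda>w. bilin (B w) u v) z = bilin (\<lambda>a b. pd x (\<lambda>w. B w a b) z) u v"
    unfolding pd_eqI[OF d] by (simp add: pd_def)
  show "(\<lambda>w. bilin (B w) u v) differentiable at z" using d by (rule differentiableI)
qed

context riemannian_coordinates begin

text \<open>The suffix \<open>C\<close> marks the complex bilinear extension: metric and Christoffel symbols applied to
  vectors with constant complex coefficients.\<close>

definition GC :: "('m \<Rightarrow> complex) \<Rightarrow> ('m \<Rightarrow> complex) \<Rightarrow> 'b \<Rightarrow> complex" where
  "GC u v w = bilin (\<lambda>a b. G w $ a $ b) u v"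

definition \<Gamma>C :: "'m \<Rightarrow> ('m \<Rightarrow> complex) \<Rightarrow> ('m \<Rightarrow> complex) \<Rightarrow> 'b \<Rightarrow> complex" where
  "\<Gamma>C p u v w = bilin (\<lambda>a b. \<Gamma> p a b w) u v"

lemma \<Gamma>C_sym: "w \<in> S \<Longrightarrow> \<Gamma>C p u v w = \<Gamma>C p v u w"
  unfolding \<Gamma>C_def using bilin_swap[of "\<lambda>a b. \<Gamma> p a b w" v u] christoffel_low_sym[of w p] by simp

lemma GC_add_right: "GC u (\<lambda>a. l * v a + m * x a) w = l * GC u v w + m * GC u x w"
  by (simp add: GC_def bilin_def sum_distrib_left algebra_simps sum.distrib)

lemma cpd_GC: "w \<in> S \<Longrightarrow> cpd e u (GC x y) w = (\<Sum>c\<in>UNIV. u c * bilin (\<lambda>a b. D1 c a b w) x y)"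
  unfolding cpd_def GC_def[abs_def] by (simp add: pd_bilin(1) diff1)

lemma differentiable_GC: "w \<in> S \<Longrightarrow> GC x y differentiable at w"
  unfolding GC_def[abs_def] by (rule pd_bilin(2)) (rule diff1)

lemma cpd_cpd_GC:
  assumes w: "w \<in> S"
  shows "cpd e u (cpd e v (GC x y)) w = (\<Sum>d\<in>UNIV. \<Sum>c\<in>UNIV. u d * v c * bilin (\<lambda>a b. D2 d c a b w) x y)"
proof -
  let ?F = "\<lambda>w. \<Sum>c\<in>UNIV. v c * bilin (\<lambda>a b. D1 c a b w) x y"
  have dF: "?F differentiable at w" for x y
    by (intro differentiable_sum ballI differentiable_mult differentiable_const finite pd_bilin(2) diff2 w)
  have "pd (e d) (cpd e v (GC x y)) w = pd (e d) ?F w" for d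
    by (rule pd_cong_open[OF open_S w, symmetric]) (auto simp: cpd_GC intro: dF)
  also have "pd (e d) ?F w = (\<Sum>c\<in>UNIV. v c * bilin (\<lambda>a b. D2 d c a b w) x y)" for d
    by (subst pd_sum)
      (auto intro!: sum.cong differentiable_mult pd_bilin(2) diff2 w
        simp: pd_bounded_linear[OF bounded_linear_mult_right] pd_bilin diff2 w)
  finally show ?thesis unfolding cpd_def[of e u] by (simp add: sum_distrib_left mult.assoc)
qed

lemma quadlin_D2: "w \<in> S \<Longrightarrow> quadlin (\<lambda>a b c d. D2 a b c d w) u v x y = cpd e u (cpd e v (GC x y)) w"
  unfolding cpd_cpd_GC quadlin_def bilin_def sum_distrib_left
  by (intro sum.cong refl) (simp add: ac_simps)

definition \<Gamma>\<Gamma>C :: "('m \<Rightarrow> complex) \<Rightarrow> ('m \<Rightarrow> complex) \<Rightarrow> ('m \<Rightarrow> complex) \<Rightarrow> ('m \<Rightarrow> complex) \<Rightarrow> 'b \<Rightarrow> complex" where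
  "\<Gamma>\<Gamma>C u v x y w = (\<Sum>p\<in>UNIV. \<Sum>q\<in>UNIV. of_real (Gi w $ p $ q) * \<Gamma>C p u v w * \<Gamma>C q x y w)"

lemma quadlin_\<Gamma>\<Gamma>: "quadlin (\<lambda>a b c d. \<Gamma>\<Gamma> a b c d w) u v x y = \<Gamma>\<Gamma>C u v x y w"
  unfolding \<Gamma>\<Gamma>_def \<Gamma>\<Gamma>C_def \<Gamma>C_def
  by (simp add: quadlin_sum quadlin_scale quadlin_product(1) mult.assoc)

text \<open>The classical formula of the curvature of a metric by second derivatives and Christoffel
  symbols, with arguments repeated in the pattern \<open>(u, v, u, v)\<close>.\<close>

lemma quadlin_riem:
  assumes w: "w \<in> S"
  shows "quadlin (riem e G w) u v u v =
    (2 * cpd e u (cpd e v (GC v u)) w - cpd e u (cpd e u (GC v v)) w - cpd e v (cpd e v (GC u u)) w) / 2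
    + \<Gamma>\<Gamma>C v u u v w - \<Gamma>\<Gamma>C u u v v w"
proof -
  have "riem e G w = (\<lambda>a b c d. (1/2) * (D2 c b d a w - D2 c a d b w - D2 d b c a w + D2 d a c b w)
     + \<Gamma>\<Gamma> d a c b w - \<Gamma>\<Gamma> c a d b w)"
    by (intro ext) (simp add: riem_formula[OF w])
  then have "quadlin (riem e G w) u v u v =
     (1/2) * (quadlin (\<lambda>a b c d. D2 a b c d w) u v v u - quadlin (\<lambda>a b c d. D2 a b c d w) u u v v
      - quadlin (\<lambda>a b c d. D2 a b c d w) v v u u + quadlin (\<lambda>a b c d. D2 a b c d w) v u u v)
     + quadlin (\<lambda>a b c d. \<Gamma>\<Gamma> a b c d w) v u u v - quadlin (\<lambda>a b c d. \<Gamma>\<Gamma> a b c d w) u u v v"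
    by (simp only: quadlin_add quadlin_diff quadlin_scale
      quadlin_perm[of "\<lambda>a b c d. D2 a b c d w"] quadlin_perm[of "\<lambda>a b c d. \<Gamma>\<Gamma> a b c d w"]) simp
  moreover have "quadlin (\<lambda>a b c d. D2 a b c d w) v u u v = quadlin (\<lambda>a b c d. D2 b a d c w) v u u v"
    by (simp only: D2_swap[OF w])
  moreover have "quadlin (\<lambda>a b c d. D2 b a d c w) v u u v = quadlin (\<lambda>a b c d. D2 a b c d w) u v v u"
    by (rule quadlin_perm(5))
  ultimately show ?thesis by (simp add: quadlin_D2[OF w] quadlin_\<Gamma>\<Gamma>)
qed

text \<open>Koszul's formula for commuting fields.\<close>

lemma \<Gamma>C_contract:
  assumes w: "w \<in> S"
  shows "(\<Sum>p\<in>UNIV. \<Gamma>C p x y w * t p) = (cpd e x (GC y t) w + cpd e y (GC x t) w - cpd e t (GC x y) w) / 2"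
proof -
  let ?D = "\<lambda>p a b. complex_of_real (D1 p a b w)"
  have rot: "(\<Sum>a\<in>UNIV. \<Sum>b\<in>UNIV. \<Sum>p\<in>UNIV. f a b p) = (\<Sum>p\<in>UNIV. \<Sum>a\<in>UNIV. \<Sum>b\<in>UNIV. f a b p)"
    for f :: "'m \<Rightarrow> 'm \<Rightarrow> 'm \<Rightarrow> complex"
  proof -
    have "(\<Sum>a\<in>UNIV. \<Sum>b\<in>UNIV. \<Sum>p\<in>UNIV. f a b p) = (\<Sum>a\<in>UNIV. \<Sum>p\<in>UNIV. \<Sum>b\<in>UNIV. f a b p)"
      by (rule sum.cong[OF refl], rule sum.swap)
    also have "\<dots> = (\<Sum>p\<in>UNIV. \<Sum>a\<in>UNIV. \<Sum>b\<in>UNIV. f a b p)" by (rule sum.swap)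
    finally show ?thesis .
  qed
  have 1: "cpd e x (GC y t) w = (\<Sum>p\<in>UNIV. \<Sum>a\<in>UNIV. \<Sum>b\<in>UNIV. ?D a b p * x a * y b * t p)"
    unfolding cpd_GC[OF w] bilin_def sum_distrib_left
    by (subst rot, intro sum.cong refl) (simp add: ac_simps)
  have 2: "cpd e y (GC x t) w = (\<Sum>p\<in>UNIV. \<Sum>a\<in>UNIV. \<Sum>b\<in>UNIV. ?D b a p * x a * y b * t p)"
    unfolding cpd_GC[OF w] bilin_def sum_distrib_left
    by (subst rot, rule sum.cong[OF refl], subst sum.swap, intro sum.cong refl) (simp add: ac_simps)
  have 3: "cpd e t (GC x y) w = (\<Sum>p\<in>UNIV. \<Sum>a\<in>UNIV. \<Sum>b\<in>UNIV. ?D p a b * x a * y b * t p)"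
    unfolding cpd_GC[OF w] bilin_def sum_distrib_left
    by (intro sum.cong refl) (simp add: ac_simps)
  show ?thesis unfolding 1 2 3 \<Gamma>C_def bilin_def christoffel_low_def
      sum.distrib[symmetric] sum_subtractf[symmetric] sum_distrib_right sum_divide_distrib
    by (intro sum.cong refl) (simp add: field_simps)
qed

text \<open>Raising the index of a covector that is already known to be a lowered vector. In this way the
  inverse of the real metric never has to be computed.\<close>

lemma inverse_pairing:
  fixes \<alpha> \<beta> v :: "'m \<Rightarrow> complex"
  assumes w: "w \<in> S" and \<beta>: "\<And>a. \<beta> a = (\<Sum>b\<in>UNIV. of_real (G w $ a $ b) * v b)"
  shows "(\<Sum>p\<in>UNIV. \<Sum>q\<in>UNIV. of_real (Gi w $ p $ q) * \<alpha> p * \<beta> q) = (\<Sum>p\<in>UNIV. \<alpha> p * v p)"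
proof -
  have "(\<Sum>q\<in>UNIV. of_real (Gi w $ p $ q) * \<beta> q) = v p" for p
  proof -
    have "(\<Sum>q\<in>UNIV. of_real (Gi w $ p $ q) * \<beta> q)
      = (\<Sum>b\<in>UNIV. of_real (\<Sum>q\<in>UNIV. Gi w $ p $ q * G w $ q $ b) * v b)"
      unfolding \<beta> of_real_sum sum_distrib_left sum_distrib_right
      by (subst sum.swap) (simp add: mult.assoc)
    then show ?thesis unfolding inverse_left[OF w]
      by (simp add: if_distrib[of "\<lambda>x. of_real x * _"] cong: if_cong)
  qed
  moreover have "(\<Sum>p\<in>UNIV. \<Sum>q\<in>UNIV. of_real (Gi w $ p $ q) * \<alpha> p * \<beta> q)
      = (\<Sum>p\<in>UNIV. \<alpha> p * (\<Sum>q\<in>UNIV. of_real (Gi w $ p $ q) * \<beta> q))"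
    unfolding sum_distrib_left by (intro sum.cong refl) (simp add: ac_simps)
  ultimately show ?thesis by simp
qed

end

section \<open>Vectors of type (1,0) and (0,1)\<close>

lemma vector_4 [simp]:
  "(vector [a, b, c, d] :: 'a::zero^4) $ 1 = a" "(vector [a, b, c, d] :: 'a::zero^4) $ 2 = b"
  "(vector [a, b, c, d] :: 'a::zero^4) $ 3 = c" "(vector [a, b, c, d] :: 'a::zero^4) $ 4 = d"
  by (simp_all add: vector_def)

lemma real_frame_simps [simp]:
  "real_frame 1 = axis 1 1" "real_frame 2 = axis 1 \<i>" "real_frame 3 = axis 2 1" "real_frame 4 = axis 2 \<i>"
  by (simp_all add: real_frame_def)

lemma axis_simps [simp]:
  "axis 1 x $ (1::2) = x" "axis 1 x $ (2::2) = 0" "axis 2 x $ (1::2) = 0" "axis 2 x $ (2::2) = x"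
  by (simp_all add: axis_def)

lemma herm_2: "herm (h::complex^2^2) X Y = h$1$1 * X$1 * cnj (Y$1) + h$1$2 * X$1 * cnj (Y$2)
    + h$2$1 * X$2 * cnj (Y$1) + h$2$2 * X$2 * cnj (Y$2)"
  by (simp add: herm_def sum_2)

text \<open>The complexified tangent vectors \<open>\<Sum>k. X\<^sup>k \<partial>/\<partial>z\<^sup>k\<close> and \<open>\<Sum>k. \<bar>X\<^sup>k \<partial>/\<partial>\<bar>z\<^sup>k\<close> by their coefficients in
  the real frame; the factor \<open>1/2\<close> is that of \<open>\<partial>/\<partial>z = (\<partial>/\<partial>x - \<i> \<partial>/\<partial>y) / 2\<close>.\<close>

definition t10 :: "complex^2 \<Rightarrow> 4 \<Rightarrow> complex" where
  "t10 X a = (\<Sum>k\<in>UNIV. X $ k * cnj (real_frame a $ k)) / 2"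

definition t01 :: "complex^2 \<Rightarrow> 4 \<Rightarrow> complex" where
  "t01 X a = (\<Sum>k\<in>UNIV. cnj (X $ k) * real_frame a $ k) / 2"

lemma t10_simps [simp]: "t10 X 1 = X$1 / 2" "t10 X 2 = - \<i> * X$1 / 2" "t10 X 3 = X$2 / 2" "t10 X 4 = - \<i> * X$2 / 2"
  by (simp_all add: t10_def sum_2)

lemma t01_simps [simp]: "t01 X 1 = cnj (X$1) / 2" "t01 X 2 = \<i> * cnj (X$1) / 2"
   "t01 X 3 = cnj (X$2) / 2" "t01 X 4 = \<i> * cnj (X$2) / 2"
  by (simp_all add: t01_def sum_2)

lemma t10_linear: "t10 (x *s X + y *s Y) a = x * t10 X a + y * t10 Y a"
  by (simp add: t10_def sum_2 field_simps)

lemma t01_linear: "t01 (x *s X + y *s Y) a = cnj x * t01 X a + cnj y * t01 Y a"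
  by (simp add: t01_def sum_2 field_simps)

lemma type_projections:
  "(\<Sum>a\<in>UNIV. t10 X a * real_frame a $ k) = X $ k" "(\<Sum>a\<in>UNIV. t10 X a * cnj (real_frame a $ k)) = 0"
  "(\<Sum>a\<in>UNIV. t01 X a * real_frame a $ k) = 0" "(\<Sum>a\<in>UNIV. t01 X a * cnj (real_frame a $ k)) = cnj (X $ k)"
  using exhaust_2[of k] by (auto simp: sum_4 field_simps)

lemma cpd_t10: "cpd real_frame (t10 X) F z = (\<Sum>i\<in>UNIV. X $ i * dz i F z)"
  by (simp add: cpd_def sum_4 sum_2 dz_def field_simps)

lemma cpd_t01: "cpd real_frame (t01 X) F z = (\<Sum>i\<in>UNIV. cnj (X $ i) * dzbar i F z)"
  by (simp add: cpd_def sum_4 sum_2 dzbar_def field_simps)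

text \<open>The vectors of both types together span the complexified tangent space.\<close>

lemma covector_eqI:
  fixes \<alpha> \<beta> :: "4 \<Rightarrow> complex"
  assumes "\<And>Z. (\<Sum>a\<in>UNIV. \<alpha> a * t10 Z a) = (\<Sum>a\<in>UNIV. \<beta> a * t10 Z a)"
    and "\<And>Z. (\<Sum>a\<in>UNIV. \<alpha> a * t01 Z a) = (\<Sum>a\<in>UNIV. \<beta> a * t01 Z a)"
  shows "\<alpha> a = \<beta> a"
proof -
  have "\<alpha> 1 = \<beta> 1 \<and> \<alpha> 2 = \<beta> 2"
    using assms(1)[of "axis 1 1"] assms(2)[of "axis 1 1"] by (auto simp: sum_4 complex_eq_iff)
  moreover have "\<alpha> 3 = \<beta> 3 \<and> \<alpha> 4 = \<beta> 4"
    using assms(1)[of "axis 2 1"] assms(2)[of "axis 2 1"] by (auto simp: sum_4 complex_eq_iff)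
  ultimately show ?thesis using exhaust_4[of a] by auto
qed

lemma dz_linear:
  assumes "\<And>k. k \<in> K \<Longrightarrow> F k differentiable at z"
  shows "dz i (\<lambda>w. \<Sum>k\<in>K. c k * F k w) z = (\<Sum>k\<in>K. c k * dz i (F k) z)"
    and "dzbar i (\<lambda>w. \<Sum>k\<in>K. c k * F k w) z = (\<Sum>k\<in>K. c k * dzbar i (F k) z)"
proof -
  have "pd v (\<lambda>w. \<Sum>k\<in>K. c k * F k w) z = (\<Sum>k\<in>K. c k * pd v (F k) z)" for v
    using assms by (simp add: pd_sum pd_bounded_linear[OF bounded_linear_mult_right])
  then show "dz i (\<lambda>w. \<Sum>k\<in>K. c k * F k w) z = (\<Sum>k\<in>K. c k * dz i (F k) z)"
    "dzbar i (\<lambda>w. \<Sum>k\<in>K. c k * F k w) z = (\<Sum>k\<in>K. c k * dzbar i (F k) z)"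
    unfolding dz_def dzbar_def
    by (simp_all add: sum_distrib_left sum_subtractf sum.distrib sum_divide_distrib algebra_simps diff_divide_distrib add_divide_distrib)
qed

lemma pd_Re_combination:
  assumes "\<And>k l. (\<lambda>w. H w k l) differentiable at z"
  shows "pd v (\<lambda>w. 2 * Re (\<Sum>k\<in>K. \<Sum>l\<in>L. H w k l * c k l)) z
      = 2 * Re (\<Sum>k\<in>K. \<Sum>l\<in>L. pd v (\<lambda>w. H w k l) z * c k l)"
    and "(\<lambda>w. 2 * Re (\<Sum>k\<in>K. \<Sum>l\<in>L. H w k l * c k l)) differentiable at z"
proof -
  have d: "((\<lambda>w. 2 * Re (\<Sum>k\<in>K. \<Sum>l\<in>L. H w k l * c k l)) has_derivative
     (\<lambda>x. 2 * Re (\<Sum>k\<in>K. \<Sum>l\<in>L. frechet_derivative (\<lambda>w. H w k l) (at z) x * c k l))) (at z)"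
    by (intro has_derivative_mult_right bounded_linear.has_derivative[OF bounded_linear_Re]
        has_derivative_sum has_derivative_mult_left assms[unfolded frechet_derivative_works])
  show "pd v (\<lambda>w. 2 * Re (\<Sum>k\<in>K. \<Sum>l\<in>L. H w k l * c k l)) z
      = 2 * Re (\<Sum>k\<in>K. \<Sum>l\<in>L. pd v (\<lambda>w. H w k l) z * c k l)"
    unfolding pd_eqI[OF d] by (simp add: pd_def)
  show "(\<lambda>w. 2 * Re (\<Sum>k\<in>K. \<Sum>l\<in>L. H w k l * c k l)) differentiable at z" using d by (rule differentiableI)
qed

locale hermitian_coordinates =
  fixes h :: "complex^2 \<Rightarrow> complex^2^2" and S :: "(complex^2) set"
  assumes open_S: "open S"
    and smooth: "\<And>k l. smooth_fun_on S (\<lambda>w. h w $ k $ l)"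
    and hermitian: "\<And>w k l. w \<in> S \<Longrightarrow> h w $ l $ k = cnj (h w $ k $ l)"
    and pos: "\<And>w X. w \<in> S \<Longrightarrow> X \<noteq> 0 \<Longrightarrow> 0 < Re (herm (h w) X X)"
begin

lemma herm_swap: "w \<in> S \<Longrightarrow> herm (h w) Y X = cnj (herm (h w) X Y)"
  using hermitian[of w 1 2] hermitian[of w 1 1] hermitian[of w 2 2] by (simp add: herm_2 algebra_simps)

lemma herm_nonzero: "w \<in> S \<Longrightarrow> X \<noteq> 0 \<Longrightarrow> herm (h w) X X \<noteq> 0"
  using pos[of w X] by auto

lemma metric_entry: "riem_metric h w $ a $ b =
    2 * Re (\<Sum>k\<in>UNIV. \<Sum>l\<in>UNIV. h w $ k $ l * (real_frame a $ k * cnj (real_frame b $ l)))"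
  by (simp add: riem_metric_def herm_def mult.assoc)

lemma metric_invertible:
  assumes w: "w \<in> S"
  shows "invertible (riem_metric h w)"
proof -
  have "v = 0" if "riem_metric h w *v v = 0" for v
  proof -
    define V where "V = (\<Sum>a\<in>UNIV. v $ a *\<^sub>R real_frame a)"
    have "0 = v \<bullet> (riem_metric h w *v v)" using that by simp
    also have "\<dots> = 2 * Re (herm (h w) V V)"
    proof -
      have V: "V $ 1 = Complex (v $ 1) (v $ 2)" "V $ 2 = Complex (v $ 3) (v $ 4)"
        by (simp_all add: V_def sum_4 complex_eq_iff)
      show ?thesis
        by (simp add: inner_vec_def matrix_vector_mult_def riem_metric_def sum_4 herm_2 V) (simp add: algebra_simps)
    qed
    finally have "V = 0" using pos[OF w, of V] by fastforce
    then have "V $ 1 = 0" "V $ 2 = 0" by simp_all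
    then have "\<forall>a. v $ a = 0" unfolding forall_4 by (simp add: V_def sum_4 complex_eq_iff)
    then show "v = 0" by (simp add: vec_eq_iff)
  qed
  then show ?thesis
    by (metis invertible_left_inverse matrix_left_invertible_ker)
qed

sublocale riemannian_coordinates real_frame "riem_metric h" S
proof
  show "open S" by (rule open_S)
  fix w a b c assume w: "w \<in> S"
  show "riem_metric h w $ a $ b = riem_metric h w $ b $ a"
    using herm_swap[OF w, of "real_frame b" "real_frame a"] by (simp add: riem_metric_def)
  show "invertible (riem_metric h w)" by (rule metric_invertible[OF w])
  note d = smooth_fun_on_differentiable[OF smooth open_S]
  show "(\<lambda>w. riem_metric h w $ a $ b) differentiable at w"
    unfolding metric_entry by (rule pd_Re_combination(2)) (rule d(1)[OF w])
  show "pd (real_frame c) (\<lambda>w. riem_metric h w $ a $ b) differentiable at w"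
  proof (rule differentiable_cong_open[OF open_S w])
    show "(\<lambda>w. 2 * Re (\<Sum>k\<in>UNIV. \<Sum>l\<in>UNIV. pd (real_frame c) (\<lambda>w. h w $ k $ l) w
        * (real_frame a $ k * cnj (real_frame b $ l)))) differentiable at w"
      by (rule pd_Re_combination(2)) (rule d(2)[OF w])
    show "2 * Re (\<Sum>k\<in>UNIV. \<Sum>l\<in>UNIV. pd (real_frame c) (\<lambda>w. h w $ k $ l) x
        * (real_frame a $ k * cnj (real_frame b $ l))) = pd (real_frame c) (\<lambda>w. riem_metric h w $ a $ b) x"
      if "x \<in> S" for x
      unfolding metric_entry by (rule pd_Re_combination(1)[symmetric]) (rule d(1)[OF that])
  qed
qed

text \<open>The Riemannian metric is twice the real part of a Hermitian form, hence invariant under the complex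
  structure. So the vectors of each type are isotropic, and the pairing of the two types is the Hermitian
  form.\<close>

lemma GC_10_10: "w \<in> S \<Longrightarrow> GC (t10 X) (t10 Y) w = 0"
 and GC_01_01: "w \<in> S \<Longrightarrow> GC (t01 X) (t01 Y) w = 0"
 and GC_10_01: "w \<in> S \<Longrightarrow> GC (t10 X) (t01 Y) w = herm (h w) X Y"
 and GC_01_10: "w \<in> S \<Longrightarrow> GC (t01 X) (t10 Y) w = herm (h w) Y X"
proof -
  assume w: "w \<in> S"
  have e: "of_real (riem_metric h w $ a $ b) = herm (h w) (real_frame a) (real_frame b) + herm (h w) (real_frame b) (real_frame a)" for a b
    unfolding herm_swap[OF w, of "real_frame b" "real_frame a"] by (simp add: riem_metric_def complex_eq_iff)
  have "bilin (\<lambda>a b. riem_metric h w $ a $ b) u v =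
      (\<Sum>k\<in>UNIV. \<Sum>l\<in>UNIV. h w $ k $ l * ((\<Sum>a\<in>UNIV. u a * real_frame a $ k) * (\<Sum>b\<in>UNIV. v b * cnj (real_frame b $ l))
       + (\<Sum>b\<in>UNIV. v b * real_frame b $ k) * (\<Sum>a\<in>UNIV. u a * cnj (real_frame a $ l))))" for u v
    unfolding bilin_def e by (simp add: sum_4 sum_2 herm_2) (simp add: algebra_simps)
  note e = this[folded GC_def]
  show "GC (t10 X) (t10 Y) w = 0" "GC (t01 X) (t01 Y) w = 0" "GC (t10 X) (t01 Y) w = herm (h w) X Y"
    "GC (t01 X) (t10 Y) w = herm (h w) Y X"
    unfolding e type_projections by (simp_all add: sum_2 herm_2)
qed

lemma cpd_cong: "w \<in> S \<Longrightarrow> f differentiable at w \<Longrightarrow> (\<And>x. x \<in> S \<Longrightarrow> f x = f' x) \<Longrightarrow> cpd real_frame u f w = cpd real_frame u f' w"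
  unfolding cpd_def by (intro sum.cong refl arg_cong2[where f="(*)"] pd_cong_open[OF open_S])

text \<open>Koszul's formula by types. The first two equations are where the Levi-Civita and the Chern connection
  agree; the last two say that \<open>\<Gamma>(\<bar>Y, X)\<close> annihilates the plane spanned by \<open>X\<close> and \<open>\<bar>Y\<close>.\<close>

lemma \<Gamma>C_types:
  assumes w: "w \<in> S"
  shows "(\<Sum>p\<in>UNIV. \<Gamma>C p (t01 Y) (t01 Y) w * t10 Z p) = cpd real_frame (t01 Y) (\<lambda>w. herm (h w) Z Y) w"
    and "(\<Sum>p\<in>UNIV. \<Gamma>C p (t10 X) (t10 X) w * t01 Z p) = cpd real_frame (t10 X) (\<lambda>w. herm (h w) X Z) w"
    and "(\<Sum>p\<in>UNIV. \<Gamma>C p (t01 Y) (t01 Y) w * t01 Z p) = 0"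
    and "(\<Sum>p\<in>UNIV. \<Gamma>C p (t01 Y) (t10 X) w * t10 X p) = 0"
    and "(\<Sum>p\<in>UNIV. \<Gamma>C p (t01 Y) (t10 X) w * t01 Y p) = 0"
proof -
  note GC = cpd_cong[OF w differentiable_GC[OF w]]
  have 0: "cpd real_frame u (GC (t10 X) (t10 Z)) w = 0" "cpd real_frame u (GC (t01 X) (t01 Z)) w = 0" for u X Z
    by (subst GC[of _ _ "\<lambda>_. 0"]; simp add: GC_10_10 GC_01_01)+
  have 1: "cpd real_frame u (GC (t01 X) (t10 Z)) w = cpd real_frame u (\<lambda>w. herm (h w) Z X) w"
    "cpd real_frame u (GC (t10 Z) (t01 X)) w = cpd real_frame u (\<lambda>w. herm (h w) Z X) w" for u X Z
    by (rule GC; simp add: GC_01_10 GC_10_01)+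
  show "(\<Sum>p\<in>UNIV. \<Gamma>C p (t01 Y) (t01 Y) w * t10 Z p) = cpd real_frame (t01 Y) (\<lambda>w. herm (h w) Z Y) w"
    "(\<Sum>p\<in>UNIV. \<Gamma>C p (t10 X) (t10 X) w * t01 Z p) = cpd real_frame (t10 X) (\<lambda>w. herm (h w) X Z) w"
    "(\<Sum>p\<in>UNIV. \<Gamma>C p (t01 Y) (t01 Y) w * t01 Z p) = 0"
    "(\<Sum>p\<in>UNIV. \<Gamma>C p (t01 Y) (t10 X) w * t10 X p) = 0"
    "(\<Sum>p\<in>UNIV. \<Gamma>C p (t01 Y) (t10 X) w * t01 Y p) = 0"
    unfolding \<Gamma>C_contract[OF w] 0 1 by simp_all
qed

lemma lower_index_GC: "w \<in> S \<Longrightarrow> (\<Sum>a\<in>UNIV. (\<Sum>b\<in>UNIV. of_real (riem_metric h w $ a $ b) * v b) * u a) = GC u v w"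
  unfolding GC_def bilin_def sum_distrib_right by (intro sum.cong refl) (simp add: ac_simps)

lemma differentiable_h:
  assumes w: "w \<in> S"
  shows "(\<lambda>w. h w $ k $ l) differentiable at w" "dz i (\<lambda>w. h w $ k $ l) differentiable at w"
    "dzbar i (\<lambda>w. h w $ k $ l) differentiable at w"
proof -
  note d = smooth_fun_on_differentiable[OF smooth open_S w]
  show "(\<lambda>w. h w $ k $ l) differentiable at w" by (rule d(1))
  have "(\<lambda>w. (pd (axis i 1) (\<lambda>w. h w $ k $ l) w - \<i> * pd (axis i \<i>) (\<lambda>w. h w $ k $ l) w) * (1 / 2)) differentiable at w"
    "(\<lambda>w. (pd (axis i 1) (\<lambda>w. h w $ k $ l) w + \<i> * pd (axis i \<i>) (\<lambda>w. h w $ k $ l) w) * (1 / 2)) differentiable at w"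
    by (intro differentiable_mult differentiable_diff differentiable_add differentiable_const d)+
  then show "dz i (\<lambda>w. h w $ k $ l) differentiable at w" "dzbar i (\<lambda>w. h w $ k $ l) differentiable at w"
    by (simp_all add: dz_def[abs_def] dzbar_def[abs_def])
qed

text \<open>A single sum over index pairs, so that \<open>dz_linear\<close> applies directly.\<close>

lemma herm_pairs: "herm (h w) X Y = (\<Sum>q\<in>UNIV. (X $ fst q * cnj (Y $ snd q)) * h w $ fst q $ snd q)"
  unfolding herm_def by (simp add: sum.cartesian_product case_prod_beta ac_simps)

lemma cpd_herm:
  assumes w: "w \<in> S"
  shows "cpd real_frame (t10 Z) (\<lambda>w. herm (h w) X Y) w
     = (\<Sum>i\<in>UNIV. \<Sum>k\<in>UNIV. \<Sum>l\<in>UNIV. Z $ i * X $ k * cnj (Y $ l) * dz i (\<lambda>w. h w $ k $ l) w)"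
    and "cpd real_frame (t01 Z) (\<lambda>w. herm (h w) X Y) w
     = (\<Sum>i\<in>UNIV. \<Sum>k\<in>UNIV. \<Sum>l\<in>UNIV. cnj (Z $ i) * X $ k * cnj (Y $ l) * dzbar i (\<lambda>w. h w $ k $ l) w)"
  unfolding cpd_t10 cpd_t01 herm_pairs
  by (subst dz_linear; simp add: differentiable_h[OF w] sum_distrib_left mult.assoc sum.cartesian_product case_prod_beta)+

end

section \<open>Comparison of the Riemann tensor with the Chern curvature\<close>

text \<open>The Chern curvature \<open>R(X, \<bar>Y, X, \<bar>Y)\<close>.\<close>

definition chern_form :: "(complex^2 \<Rightarrow> complex^2^2) \<Rightarrow> complex^2 \<Rightarrow> complex^2 \<Rightarrow> complex^2 \<Rightarrow> complex" where
  "chern_form h z X Y = (\<Sum>i\<in>UNIV. \<Sum>j\<in>UNIV. \<Sum>k\<in>UNIV. \<Sum>l\<in>UNIV.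
     chern_curv h z i j k l * X $ i * cnj (Y $ j) * X $ k * cnj (Y $ l))"

text \<open>The finite sum bookkeeping that separates the two first-derivative factors of the Chern curvature.\<close>

lemma contraction_rearrange:
  fixes x y :: "2 \<Rightarrow> complex" and g :: "2 \<Rightarrow> 2 \<Rightarrow> complex" and D E :: "2 \<Rightarrow> 2 \<Rightarrow> 2 \<Rightarrow> complex"
  shows "(\<Sum>i\<in>UNIV. \<Sum>j\<in>UNIV. \<Sum>k\<in>UNIV. \<Sum>l\<in>UNIV. (\<Sum>p\<in>UNIV. \<Sum>q\<in>UNIV. g p q * D i k q * E j p l) * x i * y j * x k * y l)
   = (\<Sum>i\<in>UNIV. \<Sum>k\<in>UNIV. \<Sum>q\<in>UNIV. x i * x k * (\<Sum>p\<in>UNIV. g p q * (\<Sum>j\<in>UNIV. \<Sum>l\<in>UNIV. y j * y l * E j p l)) * D i k q)"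
proof -
  have "(\<Sum>i\<in>UNIV. \<Sum>j\<in>UNIV. \<Sum>k\<in>UNIV. \<Sum>l\<in>UNIV. (\<Sum>p\<in>UNIV. \<Sum>q\<in>UNIV. g p q * D i k q * E j p l) * x i * y j * x k * y l)
    = (\<Sum>i\<in>UNIV. \<Sum>k\<in>UNIV. \<Sum>j\<in>UNIV. \<Sum>l\<in>UNIV. \<Sum>q\<in>UNIV. \<Sum>p\<in>UNIV. g p q * D i k q * E j p l * x i * y j * x k * y l)"
    unfolding sum_distrib_right by (rule sum.cong[OF refl], subst sum.swap, intro sum.cong refl sum.swap)
  also have "\<dots> = (\<Sum>i\<in>UNIV. \<Sum>k\<in>UNIV. \<Sum>q\<in>UNIV. \<Sum>p\<in>UNIV. \<Sum>j\<in>UNIV. \<Sum>l\<in>UNIV. g p q * D i k q * E j p l * x i * y j * x k * y l)"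
    by (rule sum.cong[OF refl], rule sum.cong[OF refl]) (simp only: sum_2 add.assoc add.left_commute add.commute)
  also have "\<dots> = (\<Sum>i\<in>UNIV. \<Sum>k\<in>UNIV. \<Sum>q\<in>UNIV. x i * x k * (\<Sum>p\<in>UNIV. g p q * (\<Sum>j\<in>UNIV. \<Sum>l\<in>UNIV. y j * y l * E j p l)) * D i k q)"
    by (intro sum.cong refl) (simp add: sum_distrib_left sum_distrib_right ac_simps)
  finally show ?thesis .
qed

context hermitian_coordinates begin

text \<open>Here complex dimension two enters: two orthogonal non-zero vectors are a basis.\<close>

lemma spanned_by_orthogonal:
  assumes w: "w \<in> S" and XY: "X \<noteq> 0" "Y \<noteq> 0" "herm (h w) X Y = 0"
  obtains x y where "Z = x *s X + y *s Y"
proof -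
  let ?D = "X$1 * Y$2 - X$2 * Y$1"
  have "?D \<noteq> 0"
  proof
    assume D: "?D = 0"
    have "herm (h w) X X * Y $ k = 0" for k
    proof -
      have "cnj (X $ l) * cnj (Y $ k) = cnj (X $ k) * cnj (Y $ l)" for l k
        using D exhaust_2[of k] exhaust_2[of l] by (auto simp: complex_cnj_mult[symmetric] simp del: complex_cnj_mult simp: algebra_simps)
      then have "herm (h w) X X * cnj (Y $ k) = herm (h w) X Y * cnj (X $ k)"
        by (simp add: herm_def sum_distrib_right mult.assoc) (simp add: mult.commute)
      then show ?thesis using XY(3) by simp
    qed
    then have "Y = 0" using herm_nonzero[OF w XY(1)] by (simp add: vec_eq_iff)
    then show False using XY by simp
  qed
  then have "Z = ((Z$1 * Y$2 - Z$2 * Y$1) / ?D) *s X + ((X$1 * Z$2 - X$2 * Z$1) / ?D) *s Y"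
    by (simp add: vec_eq_iff forall_2 divide_simps) (simp add: algebra_simps)
  then show ?thesis by (rule that)
qed

text \<open>The torsion contribution. The covector \<open>\<Gamma>(\<bar>Y, X)\<close> vanishes on \<open>X\<close> and on \<open>\<bar>Y\<close>; being determined
  by its values on \<open>Y\<close> and \<open>\<bar>X\<close>, it is the lowered form of a combination of \<open>\<bar>Y\<close> and \<open>X\<close>, and therefore
  pairs to zero with itself.\<close>

lemma mixed_christoffel_null:
  assumes w: "w \<in> S" and XY: "X \<noteq> 0" "Y \<noteq> 0" "herm (h w) X Y = 0"
  shows "\<Gamma>\<Gamma>C (t01 Y) (t10 X) (t10 X) (t01 Y) w = 0"
proof -
  let ?g = "\<lambda>p. \<Gamma>C p (t01 Y) (t10 X) w"
  \<comment> \<open>If the covector is the lowered form of \<open>l \<bar>Y + m X\<close>, evaluation on \<open>Y\<close> and \<open>\<bar>X\<close> forces these coefficients.\<close>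
  define l where "l = (\<Sum>p\<in>UNIV. ?g p * t10 Y p) / herm (h w) Y Y"
  define m where "m = (\<Sum>p\<in>UNIV. ?g p * t01 X p) / herm (h w) X X"
  define v where "v a = l * t01 Y a + m * t10 X a" for a
  have l: "l * herm (h w) Y Y = (\<Sum>p\<in>UNIV. ?g p * t10 Y p)" and m: "m * herm (h w) X X = (\<Sum>p\<in>UNIV. ?g p * t01 X p)"
    using herm_nonzero[OF w] XY by (simp_all add: l_def m_def)
  have YX: "herm (h w) Y X = 0" using herm_swap[OF w, of Y X] XY(3) by simp
  have "?g a = (\<Sum>b\<in>UNIV. of_real (riem_metric h w $ a $ b) * v b)" for a
  proof (rule covector_eqI)
    fix Z
    obtain x y where Z: "Z = x *s X + y *s Y" using spanned_by_orthogonal[OF w XY] .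
    have hZ: "herm (h w) Z Y = y * herm (h w) Y Y" "herm (h w) X Z = cnj x * herm (h w) X X"
      using XY(3) unfolding Z by (simp_all add: herm_2) algebra+
    have "(\<Sum>a\<in>UNIV. ?g a * t10 Z a) = y * (\<Sum>p\<in>UNIV. ?g p * t10 Y p)"
      unfolding Z t10_linear using \<Gamma>C_types(4)[OF w, of Y X]
      by (simp add: distrib_left sum.distrib mult.left_commute[of _ x] mult.left_commute[of _ y] sum_distrib_left[symmetric])
    also have "\<dots> = GC (t10 Z) v w"
      unfolding v_def GC_add_right GC_10_01[OF w] GC_10_10[OF w] hZ l[symmetric] by simp
    finally show "(\<Sum>a\<in>UNIV. ?g a * t10 Z a) = (\<Sum>a\<in>UNIV. (\<Sum>b\<in>UNIV. of_real (riem_metric h w $ a $ b) * v b) * t10 Z a)"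
      unfolding lower_index_GC[OF w] .
    have "(\<Sum>a\<in>UNIV. ?g a * t01 Z a) = cnj x * (\<Sum>p\<in>UNIV. ?g p * t01 X p)"
      unfolding Z t01_linear using \<Gamma>C_types(5)[OF w, of Y X]
      by (simp add: distrib_left sum.distrib mult.left_commute[of _ "cnj x"] mult.left_commute[of _ "cnj y"] sum_distrib_left[symmetric])
    also have "\<dots> = GC (t01 Z) v w"
      unfolding v_def GC_add_right GC_01_10[OF w] GC_01_01[OF w] hZ m[symmetric] by simp
    finally show "(\<Sum>a\<in>UNIV. ?g a * t01 Z a) = (\<Sum>a\<in>UNIV. (\<Sum>b\<in>UNIV. of_real (riem_metric h w $ a $ b) * v b) * t01 Z a)"
      unfolding lower_index_GC[OF w] .
  qed
  from inverse_pairing[OF w this, of ?g]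
  have "\<Gamma>\<Gamma>C (t01 Y) (t10 X) (t10 X) (t01 Y) w = (\<Sum>p\<in>UNIV. ?g p * v p)"
    unfolding \<Gamma>\<Gamma>C_def \<Gamma>C_sym[OF w, of _ "t10 X"] .
  also have "\<dots> = l * (\<Sum>p\<in>UNIV. ?g p * t01 Y p) + m * (\<Sum>p\<in>UNIV. ?g p * t10 X p)"
    unfolding v_def by (simp add: distrib_left sum.distrib mult.left_commute[of _ l] mult.left_commute[of _ m] sum_distrib_left[symmetric])
  finally show ?thesis using \<Gamma>C_types(4,5)[OF w] by simp
qed

lemma hermitian_invertible:
  assumes w: "w \<in> S" shows "invertible (h w)"
proof -
  have "X = 0" if "transpose (h w) *v X = 0" for X
  proof -
    have "herm (h w) X X = (\<Sum>l\<in>UNIV. (transpose (h w) *v X) $ l * cnj (X $ l))"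
      unfolding herm_def by (subst sum.swap) (simp add: matrix_vector_mult_def transpose_def sum_distrib_right)
    then have "herm (h w) X X = 0" using that by simp
    then show ?thesis using herm_nonzero[OF w] by blast
  qed
  then have "invertible (transpose (h w))"
    by (metis invertible_left_inverse matrix_left_invertible_ker)
  then show ?thesis by (simp add: invertible_det_nz)
qed

lemma g_inv_contract: "w \<in> S \<Longrightarrow> (\<Sum>l\<in>UNIV. h w $ k $ l * g_inv h w p l) = (if k = p then 1 else 0)"
  using arg_cong[OF matrix_inv_mult(2)[OF hermitian_invertible[of w]], of "\<lambda>B. B $ k $ p"]
  by (simp add: matrix_matrix_mult_def mat_def g_inv_def)

text \<open>The covectors \<open>\<Gamma>(X, X)\<close> and \<open>\<Gamma>(\<bar>Y, \<bar>Y)\<close> have pure type, so their inner product in the inverse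
  Riemannian metric reduces to a contraction with the inverse Hermitian matrix, which is the quadratic
  term of the Chern curvature.\<close>

lemma christoffel_product_chern:
  assumes w: "w \<in> S"
  shows "\<Gamma>\<Gamma>C (t10 X) (t10 X) (t01 Y) (t01 Y) w =
    (\<Sum>i\<in>UNIV. \<Sum>j\<in>UNIV. \<Sum>k\<in>UNIV. \<Sum>l\<in>UNIV. (\<Sum>p\<in>UNIV. \<Sum>q\<in>UNIV. g_inv h w p q *
          dz i (\<lambda>w. h w $ k $ q) w * dzbar j (\<lambda>w. h w $ p $ l) w) * X $ i * cnj (Y $ j) * X $ k * cnj (Y $ l))"
proof -
  define b where "b p = (\<Sum>j\<in>UNIV. \<Sum>l\<in>UNIV. cnj (Y $ j) * cnj (Y $ l) * dzbar j (\<lambda>w. h w $ p $ l) w)" for p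
  \<comment> \<open>The conjugate of \<open>U\<close> is the vector dual to the covector \<open>\<Gamma>(\<bar>Y, \<bar>Y)\<close>.\<close>
  define U :: "complex^2" where "U = (\<chi> q. cnj (\<Sum>p\<in>UNIV. g_inv h w p q * b p))"
  let ?\<beta> = "\<lambda>p. \<Gamma>C p (t01 Y) (t01 Y) w"
  have "?\<beta> a = (\<Sum>c\<in>UNIV. of_real (riem_metric h w $ a $ c) * t01 U c)" for a
  proof (rule covector_eqI)
    fix Z :: "complex^2"
    have "herm (h w) Z U = (\<Sum>k\<in>UNIV. Z $ k * (\<Sum>p\<in>UNIV. (\<Sum>l\<in>UNIV. h w $ k $ l * g_inv h w p l) * b p))"
      unfolding herm_def U_def
      by (simp add: sum_2 algebra_simps)
    also have "\<dots> = (\<Sum>k\<in>UNIV. Z $ k * b k)"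
      unfolding g_inv_contract[OF w] by (simp add: if_distrib[of "\<lambda>x. x * _"] cong: if_cong)
    also have "\<dots> = cpd real_frame (t01 Y) (\<lambda>w. herm (h w) Z Y) w"
      unfolding cpd_herm(2)[OF w] b_def sum_distrib_left by (subst sum.swap) (simp add: ac_simps)
    finally show "(\<Sum>a\<in>UNIV. ?\<beta> a * t10 Z a) = (\<Sum>a\<in>UNIV. (\<Sum>c\<in>UNIV. of_real (riem_metric h w $ a $ c) * t01 U c) * t10 Z a)"
      unfolding lower_index_GC[OF w] GC_10_01[OF w] \<Gamma>C_types(1)[OF w] by simp
    show "(\<Sum>a\<in>UNIV. ?\<beta> a * t01 Z a) = (\<Sum>a\<in>UNIV. (\<Sum>c\<in>UNIV. of_real (riem_metric h w $ a $ c) * t01 U c) * t01 Z a)"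
      unfolding lower_index_GC[OF w] GC_01_01[OF w] \<Gamma>C_types(3)[OF w] by simp
  qed
  from inverse_pairing[OF w this]
  have "\<Gamma>\<Gamma>C (t10 X) (t10 X) (t01 Y) (t01 Y) w = cpd real_frame (t10 X) (\<lambda>w. herm (h w) X U) w"
    unfolding \<Gamma>\<Gamma>C_def \<Gamma>C_types(2)[OF w, symmetric] .
  also have "\<dots> = (\<Sum>i\<in>UNIV. \<Sum>k\<in>UNIV. \<Sum>q\<in>UNIV. X $ i * X $ k * (\<Sum>p\<in>UNIV. g_inv h w p q * b p) * dz i (\<lambda>w. h w $ k $ q) w)"
    unfolding cpd_herm(1)[OF w] by (simp add: U_def)
  finally show ?thesis unfolding contraction_rearrange b_def .
qed

text \<open>The minus sign reflects that \<open>Rm(X, \<bar>Y, X, \<bar>Y)\<close> contains \<open>+\<partial>\<^bsub>X\<^esub> \<partial>\<^bsub>\<bar>Y\<^esub> g(X, \<bar>Y)\<close> while the Chern curvature is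
  normalised with \<open>-\<partial> \<bar>\<partial> g\<close>.\<close>

theorem riem_eq_chern:
  assumes w: "w \<in> S" and XY: "X \<noteq> 0" "Y \<noteq> 0" "herm (h w) X Y = 0"
  shows "quadlin (riem real_frame (riem_metric h) w) (t10 X) (t01 Y) (t10 X) (t01 Y) = - chern_form h w X Y"
proof -
  let ?\<xi> = "t10 X" and ?\<eta> = "t01 Y"
  have zero: "cpd real_frame u (cpd real_frame v F) w = 0" if F: "\<And>x. x \<in> S \<Longrightarrow> F x = 0" for u v F
  proof -
    have "cpd real_frame v (\<lambda>_. 0) x = cpd real_frame v F x" if "x \<in> S" for x
      by (rule cpd_cong[OF that]) (simp_all add: F)
    then have "cpd real_frame u (\<lambda>_. 0) w = cpd real_frame u (cpd real_frame v F) w"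
      by (intro cpd_cong[OF w]) simp_all
    then show ?thesis by simp
  qed
  have "cpd real_frame ?\<xi> (cpd real_frame ?\<eta> (GC ?\<eta> ?\<xi>)) w
    = cpd real_frame ?\<xi> (\<lambda>w. \<Sum>j\<in>UNIV. \<Sum>k\<in>UNIV. \<Sum>l\<in>UNIV. cnj (Y $ j) * X $ k * cnj (Y $ l) * dzbar j (\<lambda>w. h w $ k $ l) w) w"
  proof (rule cpd_cong[OF w, symmetric])
    show "(\<lambda>w. \<Sum>j\<in>UNIV. \<Sum>k\<in>UNIV. \<Sum>l\<in>UNIV. cnj (Y $ j) * X $ k * cnj (Y $ l) * dzbar j (\<lambda>w. h w $ k $ l) w) differentiable at w"
      by (intro differentiable_sum ballI finite differentiable_mult differentiable_const differentiable_h w)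
    fix x assume x: "x \<in> S"
    have "cpd real_frame ?\<eta> (GC ?\<eta> ?\<xi>) x = cpd real_frame ?\<eta> (\<lambda>w. herm (h w) X Y) x"
      by (rule cpd_cong[OF x differentiable_GC[OF x]]) (rule GC_01_10)
    then show "(\<Sum>j\<in>UNIV. \<Sum>k\<in>UNIV. \<Sum>l\<in>UNIV. cnj (Y $ j) * X $ k * cnj (Y $ l) * dzbar j (\<lambda>w. h w $ k $ l) x)
        = cpd real_frame ?\<eta> (GC ?\<eta> ?\<xi>) x"
      unfolding cpd_herm(2)[OF x] by simp
  qed
  also have "\<dots> = (\<Sum>i\<in>UNIV. \<Sum>j\<in>UNIV. \<Sum>k\<in>UNIV. \<Sum>l\<in>UNIV.
      dz i (dzbar j (\<lambda>w. h w $ k $ l)) w * X $ i * cnj (Y $ j) * X $ k * cnj (Y $ l))"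
  proof -
    have "(\<lambda>w. \<Sum>j\<in>UNIV. \<Sum>k\<in>UNIV. \<Sum>l\<in>UNIV. cnj (Y $ j) * X $ k * cnj (Y $ l) * dzbar j (\<lambda>w. h w $ k $ l) w)
      = (\<lambda>w. \<Sum>t\<in>UNIV. (cnj (Y $ fst t) * X $ fst (snd t) * cnj (Y $ snd (snd t)))
          * dzbar (fst t) (\<lambda>w. h w $ fst (snd t) $ snd (snd t)) w)"
      by (simp add: sum.cartesian_product case_prod_beta)
    then have "dz i (\<lambda>w. \<Sum>j\<in>UNIV. \<Sum>k\<in>UNIV. \<Sum>l\<in>UNIV. cnj (Y $ j) * X $ k * cnj (Y $ l) * dzbar j (\<lambda>w. h w $ k $ l) w) w
      = (\<Sum>t\<in>UNIV. (cnj (Y $ fst t) * X $ fst (snd t) * cnj (Y $ snd (snd t)))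
          * dz i (dzbar (fst t) (\<lambda>w. h w $ fst (snd t) $ snd (snd t))) w)" for i
      by (simp only:) (rule dz_linear(1), rule differentiable_h(3)[OF w])
    then show ?thesis unfolding cpd_t10
      by (simp add: sum_distrib_left sum.cartesian_product case_prod_beta ac_simps)
  qed
  finally have "quadlin (riem real_frame (riem_metric h) w) ?\<xi> ?\<eta> ?\<xi> ?\<eta> =
     (\<Sum>i\<in>UNIV. \<Sum>j\<in>UNIV. \<Sum>k\<in>UNIV. \<Sum>l\<in>UNIV.
      dz i (dzbar j (\<lambda>w. h w $ k $ l)) w * X $ i * cnj (Y $ j) * X $ k * cnj (Y $ l))
     - \<Gamma>\<Gamma>C ?\<xi> ?\<xi> ?\<eta> ?\<eta> w"
    by (simp add: quadlin_riem[OF w] zero GC_10_10 GC_01_01 mixed_christoffel_null[OF assms])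
  then show ?thesis unfolding christoffel_product_chern[OF w] chern_form_def chern_curv_def
    by (simp add: sum_subtractf[symmetric] sum_negf[symmetric] algebra_simps)
qed

end

section \<open>Polarization of the constant curvature condition\<close>

text \<open>The fourth roots of unity separate the degree difference modulo four, which isolates \<open>c02 + c20\<close>;
  the same average over \<open>(1 + \<i>)\<close> times these roots gives \<open>c20 - c02\<close>, as \<open>(1 + \<i>)\<^sup>2 = 2 \<i>\<close>.\<close>

lemma bidegree_coefficient_zero:
  fixes c00 c01 c02 c10 c11 c12 c20 c21 c22 :: complex
  assumes "\<And>t. c00 + c01 * cnj t + c02 * cnj t ^ 2 + t * (c10 + c11 * cnj t + c12 * cnj t ^ 2)
    + t ^ 2 * (c20 + c21 * cnj t + c22 * cnj t ^ 2) = 0"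
  shows "c02 = 0"
proof -
  let ?F = "\<lambda>t. c00 + c01 * cnj t + c02 * cnj t ^ 2 + t * (c10 + c11 * cnj t + c12 * cnj t ^ 2)
    + t ^ 2 * (c20 + c21 * cnj t + c22 * cnj t ^ 2)"
  have i: "\<i> * (\<i> * z) = - z" for z :: complex by (simp add: mult.assoc[symmetric])
  have "4 * (c02 + c20) = ?F 1 + ?F (-1) - ?F \<i> - ?F (- \<i>)"
    by (simp add: power2_eq_square algebra_simps i)
  moreover have "8 * \<i> * (c20 - c02) = ?F (1 + \<i>) + ?F (- (1 + \<i>)) - ?F (1 - \<i>) - ?F (- (1 - \<i>))"
    by (simp add: power2_eq_square algebra_simps i)
  ultimately have "c02 + c20 = 0" "c20 - c02 = 0" unfolding assms by simp_all
  then show ?thesis by algebra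
qed

text \<open>Expand \<open>Q (X + t Y) (X + t Y)\<close> in \<open>t\<close> and its conjugate: the value \<open>Q X Y\<close> is the coefficient
  of the square of the conjugate.\<close>

lemma hermitian_polarization:
  fixes T :: "'n::finite \<Rightarrow> 'n \<Rightarrow> 'n \<Rightarrow> 'n \<Rightarrow> complex"
  defines "Q \<equiv> \<lambda>X Y. \<Sum>i\<in>UNIV. \<Sum>j\<in>UNIV. \<Sum>k\<in>UNIV. \<Sum>l\<in>UNIV. T i j k l * X $ i * cnj (Y $ j) * X $ k * cnj (Y $ l)"
  assumes "\<And>X. Q X X = 0"
  shows "Q X Y = 0"
proof -
  define m where "m X Y Z W = (\<Sum>i\<in>UNIV. \<Sum>j\<in>UNIV. \<Sum>k\<in>UNIV. \<Sum>l\<in>UNIV.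
      T i j k l * X $ i * cnj (Y $ j) * Z $ k * cnj (W $ l))" for X Y Z W :: "complex^'n"
  have lin: "m (X + t *s X') Y Z W = m X Y Z W + t * m X' Y Z W"
    "m X (Y + t *s Y') Z W = m X Y Z W + cnj t * m X Y' Z W"
    "m X Y (Z + t *s Z') W = m X Y Z W + t * m X Y Z' W"
    "m X Y Z (W + t *s W') = m X Y Z W + cnj t * m X Y Z W'" for X Y Z W X' Y' Z' W' t
    unfolding m_def by (simp_all add: distrib_left distrib_right sum.distrib sum_distrib_left ac_simps)
  have "m X X X X + (m X Y X X + m X X X Y) * cnj t + m X Y X Y * cnj t ^ 2
    + t * ((m Y X X X + m X X Y X) + (m Y Y X X + m Y X X Y + m X Y Y X + m X X Y Y) * cnj t
       + (m Y Y X Y + m X Y Y Y) * cnj t ^ 2)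
    + t ^ 2 * (m Y X Y X + (m Y Y Y X + m Y X Y Y) * cnj t + m Y Y Y Y * cnj t ^ 2) = 0" for t
  proof -
    have "m (X + t *s Y) (X + t *s Y) (X + t *s Y) (X + t *s Y) = 0"
      using assms(2)[of "X + t *s Y"] unfolding Q_def m_def .
    then show ?thesis unfolding lin by (simp add: power2_eq_square algebra_simps)
  qed
  from bidegree_coefficient_zero[OF this] show ?thesis unfolding Q_def m_def .
qed

context hermitian_coordinates begin

text \<open>Subtracting \<open>g \<otimes> B\<close> with \<open>B = (C g - \<alpha> Ric) / \<beta>\<close> from the Chern curvature leaves a form that
  vanishes on the diagonal, so it vanishes off the diagonal; for orthogonal arguments the subtracted term
  is zero as well.\<close>

lemma chern_form_null:
  assumes w: "w \<in> S" and \<beta>: "\<beta> \<noteq> 0" and C: "\<And>X. X \<noteq> 0 \<Longrightarrow> mixed_curv k \<alpha> \<beta> h w X = C"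
    and XY: "herm (h w) X Y = 0"
  shows "chern_form h w X Y = 0"
proof -
  define B where "B i j = (C * h w $ i $ j - of_real \<alpha> * chern_ricci k h w i j) / of_real \<beta>" for i j
  define T where "T i j k l = chern_curv h w i j k l - h w $ i $ j * B k l" for i j k l
  let ?Q = "\<lambda>T X Y. \<Sum>i\<in>UNIV. \<Sum>j\<in>UNIV. \<Sum>k\<in>UNIV. \<Sum>l\<in>UNIV. T i j k l * X $ i * cnj (Y $ j) * X $ k * cnj (Y $ l)"
  have Q: "?Q T X Y = chern_form h w X Y - herm (h w) X Y * (\<Sum>i\<in>UNIV. \<Sum>j\<in>UNIV. B i j * X $ i * cnj (Y $ j))" for X Y
    unfolding chern_form_def herm_def sum_distrib_right unfolding sum_distrib_left sum_subtractf[symmetric] T_def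
    by (intro sum.cong refl) (simp add: algebra_simps)
  have "?Q T X X = 0" for X
  proof (cases "X = 0")
    case False
    let ?n = "herm (h w) X X" and ?R = "\<Sum>a\<in>UNIV. \<Sum>b\<in>UNIV. chern_ricci k h w a b * X $ a * cnj (X $ b)"
    have n: "?n \<noteq> 0" using herm_nonzero[OF w False] .
    have "of_real \<alpha> / ?n * ?R + of_real \<beta> * (chern_form h w X X / ?n\<^sup>2) = C"
      using C[OF False] unfolding mixed_curv_def hol_sect_curv_def chern_form_def .
    then have "of_real \<beta> * chern_form h w X X = ?n * (C * ?n - of_real \<alpha> * ?R)"
      using n by (simp add: field_simps power2_eq_square)
    also have "C * ?n - of_real \<alpha> * ?R = of_real \<beta> * (\<Sum>i\<in>UNIV. \<Sum>j\<in>UNIV. B i j * X $ i * cnj (X $ j))"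
      unfolding B_def herm_def using \<beta>
      by (simp add: sum_distrib_left sum_subtractf[symmetric] left_diff_distrib mult.assoc)
    finally show ?thesis unfolding Q using \<beta> by simp
  qed simp
  then have "?Q T X Y = 0" by (rule hermitian_polarization)
  then show ?thesis unfolding Q XY by simp
qed

lemma weyl_null:
  assumes w: "w \<in> S" and "\<beta> \<noteq> 0" "\<And>X. X \<noteq> 0 \<Longrightarrow> mixed_curv k \<alpha> \<beta> h w X = C"
    and XY: "X \<noteq> 0" "Y \<noteq> 0" "herm (h w) X Y = 0"
  shows "quadlin (weyl real_frame (riem_metric h) w) (t10 X) (t01 Y) (t10 X) (t01 Y) = 0"
proof -
  have "quadlin (weyl real_frame (riem_metric h) w) (t10 X) (t01 Y) (t10 X) (t01 Y)
     = quadlin (riem real_frame (riem_metric h) w) (t10 X) (t01 Y) (t10 X) (t01 Y)"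
    by (rule quadlin_weyl; fold GC_def; simp add: GC_10_10 GC_01_01 GC_10_01 GC_01_10 w XY)
  then show ?thesis using riem_eq_chern[OF w XY] chern_form_null[OF assms(1-3,6)] by simp
qed

end

section \<open>Curvature tensors vanishing on null anti-self-dual bivectors\<close>

lemma alternating_4:
  fixes N :: "4 \<Rightarrow> 4 \<Rightarrow> complex"
  assumes "\<And>a b. N b a = - N a b"
  shows "(\<Sum>a\<in>UNIV. \<Sum>b\<in>UNIV. N a b * u a * v b) =
    N 1 2 * (u 1 * v 2 - u 2 * v 1) + N 1 3 * (u 1 * v 3 - u 3 * v 1) + N 1 4 * (u 1 * v 4 - u 4 * v 1)
    + N 2 3 * (u 2 * v 3 - u 3 * v 2) + N 2 4 * (u 2 * v 4 - u 4 * v 2) + N 3 4 * (u 3 * v 4 - u 4 * v 3)"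
proof -
  have "N a a = 0" for a using assms[of a a] by (simp add: eq_neg_iff_add_eq_0)
  then show ?thesis
    by (simp add: sum_4 assms[of 1 2] assms[of 1 3] assms[of 1 4] assms[of 2 3] assms[of 2 4] assms[of 3 4] algebra_simps)
qed

text \<open>On antisymmetric tensors the value depends only on the six components of \<open>u \<and> v\<close>, which keeps the
  explicit evaluation below small.\<close>

lemma quadlin_bivector:
  fixes T :: "4 \<Rightarrow> 4 \<Rightarrow> 4 \<Rightarrow> 4 \<Rightarrow> real"
  assumes "curvature_like T"
  defines "p \<equiv> \<lambda>u v a b. u a * v b - u b * v a"
  shows "quadlin T u v u v =
     (\<Sum>(a, b) \<in> {(1,2), (1,3), (1,4), (2,3), (2,4), (3,4)}. \<Sum>(c, d) \<in> {(1,2), (1,3), (1,4), (2,3), (2,4), (3,4)}.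
        of_real (T a b c d) * p u v a b * p u v c d)"
proof -
  let ?I = "{(1,2), (1,3), (1,4), (2,3), (2,4), (3,4)} :: (4 \<times> 4) set"
  note T = curvature_likeD[OF assms(1)]
  have alt: "(\<Sum>a\<in>UNIV. \<Sum>b\<in>UNIV. N a b * u a * v b) = (\<Sum>(a, b)\<in>?I. N a b * p u v a b)"
    if "\<And>a b. N b a = - N a b" for N :: "4 \<Rightarrow> 4 \<Rightarrow> complex"
    unfolding alternating_4[of N u v, OF that] by (simp add: p_def)
  define N where "N a b = (\<Sum>c\<in>UNIV. \<Sum>d\<in>UNIV. of_real (T a b c d) * u c * v d)" for a b
  have N: "N a b = (\<Sum>(c, d)\<in>?I. of_real (T a b c d) * p u v c d)" for a b
    unfolding N_def
  proof (rule alt)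
    show "complex_of_real (T a b d c) = - of_real (T a b c d)" for c d by (simp add: T(2)[of a b c d])
  qed
  have "quadlin T u v u v = (\<Sum>a\<in>UNIV. \<Sum>b\<in>UNIV. N a b * u a * v b)"
    unfolding quadlin_def N_def sum_distrib_right by (simp add: ac_simps)
  also have "\<dots> = (\<Sum>(a, b)\<in>?I. N a b * p u v a b)"
  proof (rule alt)
    show "N b a = - N a b" for a b
      unfolding N_def sum_negf[symmetric] by (intro sum.cong refl) (simp add: T(1)[of b a])
  qed
  finally show ?thesis unfolding N case_prod_beta sum_distrib_right
    by (elim trans, intro sum.cong refl) (simp only: ac_simps)
qed

text \<open>Let \<open>\<phi>\<^sub>1 = e\<^bsub>12\<^esub> - e\<^bsub>34\<^esub>\<close>, \<open>\<phi>\<^sub>2 = e\<^bsub>13\<^esub> + e\<^bsub>24\<^esub>\<close>, \<open>\<phi>\<^sub>3 = e\<^bsub>14\<^esub> - e\<^bsub>23\<^esub>\<close> be the basis of the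
  anti-self-dual bivectors. Three orthogonal pairs give the null vectors \<open>\<phi>\<^sub>2 + \<i> \<phi>\<^sub>3\<close>,
  \<open>\<phi>\<^sub>2 - \<i> \<phi>\<^sub>1\<close> and \<open>\<phi>\<^sub>3 - \<i> \<phi>\<^sub>1\<close>, up to factors. Their real and imaginary parts say that the
  symmetric matrix \<open>w(\<phi>\<^sub>i, \<phi>\<^sub>j)\<close> is a multiple of the identity. The trace condition and the Bianchi
  identity force that multiple to be zero, and the trace condition makes \<open>w\<close> vanish between
  anti-self-dual and self-dual bivectors.\<close>

lemma anti_self_dual_part_zero:
  fixes w :: "4 \<Rightarrow> 4 \<Rightarrow> 4 \<Rightarrow> 4 \<Rightarrow> real"
  assumes w: "curvature_like w" and tr: "\<And>j l. (\<Sum>i\<in>UNIV. w i j i l) = 0"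
    and null: "\<And>U V. U \<noteq> 0 \<Longrightarrow> V \<noteq> 0 \<Longrightarrow> U $ 1 * cnj (V $ 1) + U $ 2 * cnj (V $ 2) = 0 \<Longrightarrow>
      quadlin w (t10 U) (t01 V) (t10 U) (t01 V) = 0"
  shows "w 1 2 k l = w 3 4 k l" "w 1 3 k l = - w 2 4 k l" "w 1 4 k l = w 2 3 k l"
proof -
  note T = curvature_likeD[OF w]
  have null': "quadlin w (t10 (vector [a, b])) (t01 (vector [c, d])) (t10 (vector [a, b])) (t01 (vector [c, d])) = 0"
    if "a \<noteq> 0 \<or> b \<noteq> 0" "c \<noteq> 0 \<or> d \<noteq> 0" "a * cnj c + b * cnj d = 0" for a b c d
    using that by (intro null) (auto simp: vec_eq_iff forall_2)
  have sym: "w 1 3 1 2 = w 1 2 1 3" "w 1 4 1 2 = w 1 2 1 4" "w 2 3 1 2 = w 1 2 2 3" "w 2 4 1 2 = w 1 2 2 4" "w 3 4 1 2 = w 1 2 3 4"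
     "w 1 4 1 3 = w 1 3 1 4" "w 2 3 1 3 = w 1 3 2 3" "w 2 4 1 3 = w 1 3 2 4" "w 3 4 1 3 = w 1 3 3 4"
     "w 2 3 1 4 = w 1 4 2 3" "w 2 4 1 4 = w 1 4 2 4" "w 3 4 1 4 = w 1 4 3 4"
     "w 2 4 2 3 = w 2 3 2 4" "w 3 4 2 3 = w 2 3 3 4" "w 3 4 2 4 = w 2 4 3 4"
    by (rule T(3))+
  have flip: "w 2 1 k l = - w 1 2 k l" "w 3 1 k l = - w 1 3 k l" "w 4 1 k l = - w 1 4 k l"
    "w 3 2 k l = - w 2 3 k l" "w 4 2 k l = - w 2 4 k l" "w 4 3 k l = - w 3 4 k l"
    "w k l 2 1 = - w k l 1 2" "w k l 3 1 = - w k l 1 3" "w k l 4 1 = - w k l 1 4"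
    "w k l 3 2 = - w k l 2 3" "w k l 4 2 = - w k l 2 4" "w k l 4 3 = - w k l 3 4" for k l
    by (rule T(1), rule T(1), rule T(1), rule T(1), rule T(1), rule T(1), rule T(2), rule T(2), rule T(2), rule T(2), rule T(2), rule T(2))
  have diag: "w k k a b = 0" "w a b k k = 0" for k a b
    using T(1)[of k k a b] T(2)[of a b k k] by simp_all
  note norm = sym flip diag
  \<comment> \<open>The orthogonal pairs are \<open>(1, 0), (0, 1)\<close>, then \<open>(1, 1), (1, -1)\<close>, then \<open>(1, \<i>), (1, -\<i>)\<close>.\<close>
  have e1: "w 1 3 1 3 + w 2 4 2 4 + 2 * w 1 3 2 4 = w 1 4 1 4 + w 2 3 2 3 - 2 * w 1 4 2 3"
    and e2: "w 1 3 1 4 - w 1 3 2 3 + w 1 4 2 4 - w 2 3 2 4 = 0"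
    using null'[of 1 0 0 1] unfolding quadlin_bivector[OF w] by (simp_all add: complex_eq_iff norm)
  have e3: "w 1 3 1 3 + w 2 4 2 4 + 2 * w 1 3 2 4 = w 1 2 1 2 + w 3 4 3 4 - 2 * w 1 2 3 4"
    and e4: "w 1 2 1 3 + w 1 2 2 4 - w 1 3 3 4 - w 2 4 3 4 = 0"
    using null'[of 1 1 1 "-1"] unfolding quadlin_bivector[OF w] by (simp_all add: complex_eq_iff norm)
  have e5: "w 1 2 1 4 - w 1 2 2 3 - w 1 4 3 4 + w 2 3 3 4 = 0"
    using null'[of 1 \<i> 1 "-\<i>"] unfolding quadlin_bivector[OF w] by (simp_all add: complex_eq_iff norm)
  have tr': "w 1 j 1 l + w 2 j 2 l + w 3 j 3 l + w 4 j 4 l = 0" for j l using tr[of j l] by (simp add: sum_4)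
  note t = tr'[of 1 1] tr'[of 2 2] tr'[of 3 3] tr'[of 4 4] tr'[of 1 2] tr'[of 1 3] tr'[of 1 4] tr'[of 2 3] tr'[of 2 4] tr'[of 3 4]
  note t = t[unfolded norm]
  have b: "w 1 2 3 4 - w 1 3 2 4 + w 1 4 2 3 = 0" using T(4)[of 1 2 3 4] by (simp add: norm)
  have "w 1 2 k l = w 3 4 k l \<and> w 1 3 k l = - w 2 4 k l \<and> w 1 4 k l = w 2 3 k l"
    if "(k, l) \<in> {(1,2), (1,3), (1,4), (2,3), (2,4), (3,4)}" for k l
    using that e1 e2 e3 e4 e5 t b by (auto simp: norm)
  note 1 = this
  have "w 1 2 k l = w 3 4 k l \<and> w 1 3 k l = - w 2 4 k l \<and> w 1 4 k l = w 2 3 k l"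
    using 1[of k l] 1[of l k] exhaust_4[of k] exhaust_4[of l] by (auto simp: flip diag)
  then show "w 1 2 k l = w 3 4 k l" "w 1 3 k l = - w 2 4 k l" "w 1 4 k l = w 2 3 k l" by auto
qed

section \<open>Change of frame\<close>

definition frame_tensor :: "('m::finite \<Rightarrow> 'm \<Rightarrow> 'm \<Rightarrow> 'm \<Rightarrow> real) \<Rightarrow> ('m \<Rightarrow> 'm \<Rightarrow> real) \<Rightarrow> 'm \<Rightarrow> 'm \<Rightarrow> 'm \<Rightarrow> 'm \<Rightarrow> real" where
  "frame_tensor T P i j k l = (\<Sum>a\<in>UNIV. \<Sum>b\<in>UNIV. \<Sum>c\<in>UNIV. \<Sum>d\<in>UNIV. T a b c d * P a i * P b j * P c k * P d l)"

lemma frame_tensor_quadlin: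
  "of_real (frame_tensor T P i j k l) = quadlin T (\<lambda>a. of_real (P a i)) (\<lambda>a. of_real (P a j)) (\<lambda>a. of_real (P a k)) (\<lambda>a. of_real (P a l))"
  by (simp add: frame_tensor_def quadlin_def)

lemma curvature_like_frame_tensor:
  assumes "curvature_like T"
  shows "curvature_like (frame_tensor T P)"
proof -
  note q = quadlin_curvature_like[OF assms]
  have "complex_of_real (frame_tensor T P b a c d) = of_real (- frame_tensor T P a b c d)"
    "complex_of_real (frame_tensor T P a b d c) = of_real (- frame_tensor T P a b c d)"
    "complex_of_real (frame_tensor T P c d a b) = of_real (frame_tensor T P a b c d)"
    "complex_of_real (frame_tensor T P a b c d + frame_tensor T P a c d b + frame_tensor T P a d b c) = of_real 0" for a b c d
    unfolding of_real_add of_real_minus frame_tensor_quadlin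
    by (rule q(1), rule q(2), rule q(3), simp add: q(4))
  then show ?thesis unfolding curvature_like_def of_real_eq_iff by blast
qed

lemma quadlin_frame_change:
  "quadlin T (\<lambda>a. \<Sum>i\<in>UNIV. of_real (P a i) * \<alpha> i) (\<lambda>a. \<Sum>i\<in>UNIV. of_real (P a i) * \<beta> i)
     (\<lambda>a. \<Sum>i\<in>UNIV. of_real (P a i) * \<gamma> i) (\<lambda>a. \<Sum>i\<in>UNIV. of_real (P a i) * \<delta> i)
   = quadlin (frame_tensor T P) \<alpha> \<beta> \<gamma> \<delta>"
proof -
  have lin: "quadlin T (\<lambda>a. \<Sum>i\<in>UNIV. p a i * e i) v w x = (\<Sum>i\<in>UNIV. e i * quadlin T (\<lambda>a. p a i) v w x)"
      "quadlin T v (\<lambda>a. \<Sum>i\<in>UNIV. p a i * e i) w x = (\<Sum>i\<in>UNIV. e i * quadlin T v (\<lambda>a. p a i) w x)"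
      "quadlin T v w (\<lambda>a. \<Sum>i\<in>UNIV. p a i * e i) x = (\<Sum>i\<in>UNIV. e i * quadlin T v w (\<lambda>a. p a i) x)"
      "quadlin T v w x (\<lambda>a. \<Sum>i\<in>UNIV. p a i * e i) = (\<Sum>i\<in>UNIV. e i * quadlin T v w x (\<lambda>a. p a i))"
    for p :: "'a \<Rightarrow> 'a \<Rightarrow> complex" and e v w x
  proof -
    have 1: "quadlin T (\<lambda>a. \<Sum>i\<in>UNIV. p a i * e i) v w x = (\<Sum>i\<in>UNIV. e i * quadlin T (\<lambda>a. p a i) v w x)" for T v w x
    proof -
      have prod: "quadlin T s v w x = (\<Sum>a\<in>UNIV. s a * (\<Sum>b\<in>UNIV. \<Sum>c\<in>UNIV. \<Sum>d\<in>UNIV. of_real (T a b c d) * v b * w c * x d))" for s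
        unfolding quadlin_def sum_distrib_left by (intro sum.cong refl) (simp only: ac_simps)
      have "quadlin T (\<lambda>a. \<Sum>i\<in>UNIV. p a i * e i) v w x
        = (\<Sum>a\<in>UNIV. (\<Sum>i\<in>UNIV. p a i * e i) * (\<Sum>b\<in>UNIV. \<Sum>c\<in>UNIV. \<Sum>d\<in>UNIV. of_real (T a b c d) * v b * w c * x d))"
        using prod[of "\<lambda>a. \<Sum>i\<in>UNIV. p a i * e i"] .
      also have "\<dots> = (\<Sum>i\<in>UNIV. \<Sum>a\<in>UNIV. p a i * e i * (\<Sum>b\<in>UNIV. \<Sum>c\<in>UNIV. \<Sum>d\<in>UNIV. of_real (T a b c d) * v b * w c * x d))"
        unfolding sum_distrib_right by (rule sum.swap)
      also have "\<dots> = (\<Sum>i\<in>UNIV. e i * quadlin T (\<lambda>a. p a i) v w x)"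
        unfolding quadlin_def sum_distrib_left by (intro sum.cong refl) (simp add: ac_simps)
      finally show ?thesis .
    qed
    have 2: "quadlin T v (\<lambda>a. \<Sum>i\<in>UNIV. p a i * e i) w x = (\<Sum>i\<in>UNIV. e i * quadlin T v (\<lambda>a. p a i) w x)" for T v w x
      using 1[of "\<lambda>a b c d. T b a c d" v w x] by (simp only: quadlin_swaps(1)[of T])
    have 3: "quadlin T v w (\<lambda>a. \<Sum>i\<in>UNIV. p a i * e i) x = (\<Sum>i\<in>UNIV. e i * quadlin T v w (\<lambda>a. p a i) x)" for T v w x
      using 2[of "\<lambda>a b c d. T a c b d" v w x] by (simp only: quadlin_swaps(2)[of T])
    show "quadlin T v w x (\<lambda>a. \<Sum>i\<in>UNIV. p a i * e i) = (\<Sum>i\<in>UNIV. e i * quadlin T v w x (\<lambda>a. p a i))"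
      using 3[of "\<lambda>a b c d. T a b d c" v w x] by (simp only: quadlin_swaps(3)[of T])
    show "quadlin T (\<lambda>a. \<Sum>i\<in>UNIV. p a i * e i) v w x = (\<Sum>i\<in>UNIV. e i * quadlin T (\<lambda>a. p a i) v w x)"
      "quadlin T v (\<lambda>a. \<Sum>i\<in>UNIV. p a i * e i) w x = (\<Sum>i\<in>UNIV. e i * quadlin T v (\<lambda>a. p a i) w x)"
      "quadlin T v w (\<lambda>a. \<Sum>i\<in>UNIV. p a i * e i) x = (\<Sum>i\<in>UNIV. e i * quadlin T v w (\<lambda>a. p a i) x)"
      by (rule 1, rule 2, rule 3)
  qed
  show ?thesis unfolding lin frame_tensor_quadlin[symmetric]
    unfolding quadlin_def sum_distrib_left by (intro sum.cong refl) (simp add: ac_simps)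
qed

lemma frame_tensor_trace:
  assumes "\<And>b d. (\<Sum>a\<in>UNIV. \<Sum>c\<in>UNIV. (\<Sum>i\<in>UNIV. P a i * P c i) * T a b c d) = 0"
  shows "(\<Sum>i\<in>UNIV. frame_tensor T P i j i l) = 0"
proof -
  let ?F = "\<lambda>i a b c d. T a b c d * P a i * P b j * P c i * P d l"
  have "(\<Sum>i\<in>UNIV. frame_tensor T P i j i l) = (\<Sum>i\<in>UNIV. \<Sum>b\<in>UNIV. \<Sum>a\<in>UNIV. \<Sum>d\<in>UNIV. \<Sum>c\<in>UNIV. ?F i a b c d)"
    unfolding frame_tensor_def
    by (rule sum.cong[OF refl], subst sum.swap, rule sum.cong[OF refl], rule sum.cong[OF refl], rule sum.swap)
  also have "\<dots> = (\<Sum>i\<in>UNIV. \<Sum>b\<in>UNIV. \<Sum>d\<in>UNIV. \<Sum>a\<in>UNIV. \<Sum>c\<in>UNIV. ?F i a b c d)"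
    by (rule sum.cong[OF refl], rule sum.cong[OF refl], rule sum.swap)
  also have "\<dots> = (\<Sum>b\<in>UNIV. \<Sum>i\<in>UNIV. \<Sum>d\<in>UNIV. \<Sum>a\<in>UNIV. \<Sum>c\<in>UNIV. ?F i a b c d)"
    by (rule sum.swap)
  also have "\<dots> = (\<Sum>b\<in>UNIV. \<Sum>d\<in>UNIV. \<Sum>i\<in>UNIV. \<Sum>a\<in>UNIV. \<Sum>c\<in>UNIV. ?F i a b c d)"
    by (rule sum.cong[OF refl], rule sum.swap)
  also have "\<dots> = (\<Sum>b\<in>UNIV. \<Sum>d\<in>UNIV. \<Sum>a\<in>UNIV. \<Sum>i\<in>UNIV. \<Sum>c\<in>UNIV. ?F i a b c d)"
    by (rule sum.cong[OF refl], rule sum.cong[OF refl], rule sum.swap)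
  also have "\<dots> = (\<Sum>b\<in>UNIV. \<Sum>d\<in>UNIV. \<Sum>a\<in>UNIV. \<Sum>c\<in>UNIV. \<Sum>i\<in>UNIV. ?F i a b c d)"
    by (rule sum.cong[OF refl], rule sum.cong[OF refl], rule sum.cong[OF refl], rule sum.swap)
  also have "\<dots> = (\<Sum>b\<in>UNIV. \<Sum>d\<in>UNIV. P b j * P d l * (\<Sum>a\<in>UNIV. \<Sum>c\<in>UNIV. (\<Sum>i\<in>UNIV. P a i * P c i) * T a b c d))"
    unfolding sum_distrib_left sum_distrib_right by (intro sum.cong refl) (simp only: ac_simps)
  finally show ?thesis by (simp add: assms)
qed

lemma congruence_entry:
  fixes A N B :: "real^'m^'m"
  shows "(A ** N ** B) $ k $ l = (\<Sum>p\<in>UNIV. \<Sum>q\<in>UNIV. A $ k $ p * N $ p $ q * B $ q $ l)"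
  by (subst sum.swap) (simp add: matrix_matrix_mult_def sum_distrib_right)

lemma congruence_zero:
  fixes N P :: "real^'m^'m"
  assumes "invertible P" "transpose P ** N ** P = 0"
  shows "N = 0"
proof -
  obtain Q where Q: "P ** Q = mat 1" using assms(1) unfolding invertible_def by blast
  then have Q': "transpose Q ** transpose P = mat 1" using matrix_transpose_mul[of P Q] by simp
  have "transpose Q ** (transpose P ** N ** P) ** Q = (transpose Q ** transpose P) ** N ** (P ** Q)"
    by (simp add: matrix_mul_assoc)
  then show ?thesis unfolding assms(2) Q Q' by simp
qed

definition two_form_component :: "real^4^4 \<Rightarrow> (4 \<Rightarrow> 4 \<Rightarrow> real) \<Rightarrow> 4 \<Rightarrow> 4 \<Rightarrow> real" where
  "two_form_component P \<omega> i j = (\<Sum>a\<in>UNIV. \<Sum>b\<in>UNIV. P $ a $ i * P $ b $ j * \<omega> a b)"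

lemma frame_tensor_congruence:
  "frame_tensor T (\<lambda>a i. P $ a $ i) i j k l
    = (transpose P ** (\<chi> p q. two_form_component P (\<lambda>a b. T a b p q) i j) ** P) $ k $ l"
proof -
  let ?F = "\<lambda>a b p q. T a b p q * P $ a $ i * P $ b $ j * P $ p $ k * P $ q $ l"
  have "frame_tensor T (\<lambda>a i. P $ a $ i) i j k l = (\<Sum>a\<in>UNIV. \<Sum>p\<in>UNIV. \<Sum>b\<in>UNIV. \<Sum>q\<in>UNIV. ?F a b p q)"
    unfolding frame_tensor_def by (rule sum.cong[OF refl], rule sum.swap)
  also have "\<dots> = (\<Sum>a\<in>UNIV. \<Sum>p\<in>UNIV. \<Sum>q\<in>UNIV. \<Sum>b\<in>UNIV. ?F a b p q)"
    by (rule sum.cong[OF refl], rule sum.cong[OF refl], rule sum.swap)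
  also have "\<dots> = (\<Sum>p\<in>UNIV. \<Sum>a\<in>UNIV. \<Sum>q\<in>UNIV. \<Sum>b\<in>UNIV. ?F a b p q)"
    by (rule sum.swap)
  also have "\<dots> = (\<Sum>p\<in>UNIV. \<Sum>q\<in>UNIV. \<Sum>a\<in>UNIV. \<Sum>b\<in>UNIV. ?F a b p q)"
    by (rule sum.cong[OF refl], rule sum.swap)
  also have "\<dots> = (\<Sum>q\<in>UNIV. \<Sum>p\<in>UNIV. \<Sum>a\<in>UNIV. \<Sum>b\<in>UNIV. ?F a b p q)"
    by (rule sum.swap)
  also have "\<dots> = (\<Sum>q\<in>UNIV. (\<Sum>p\<in>UNIV. P $ p $ k * two_form_component P (\<lambda>a b. T a b p q) i j) * P $ q $ l)"
    unfolding two_form_component_def sum_distrib_left sum_distrib_right by (intro sum.cong refl) (simp only: ac_simps)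
  also have "\<dots> = (transpose P ** (\<chi> p q. two_form_component P (\<lambda>a b. T a b p q) i j) ** P) $ k $ l"
    by (simp add: matrix_matrix_mult_def transpose_def)
  finally show ?thesis .
qed

text \<open>As the frame is a basis, the last two slots may be filled with coordinate vectors instead of frame
  vectors, without changing the first two.\<close>

lemma frame_tensor_first_pair:
  assumes P: "invertible P"
    and ft: "\<And>k l. frame_tensor T (\<lambda>a i. P $ a $ i) i j k l = s * frame_tensor T (\<lambda>a i. P $ a $ i) i' j' k l"
  shows "two_form_component P (\<lambda>a b. T a b p q) i j = s * two_form_component P (\<lambda>a b. T a b p q) i' j'"
proof -
  define B where "B i j = (\<chi> p q. two_form_component P (\<lambda>a b. T a b p q) i j)" for i j
  have conj: "(transpose P ** N ** P) $ k $ l = (\<Sum>q\<in>UNIV. \<Sum>p\<in>UNIV. P $ p $ k * N $ p $ q * P $ q $ l)" for N k l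
    by (simp add: matrix_matrix_mult_def transpose_def sum_distrib_right)
  have "(transpose P ** (B i j - s *\<^sub>R B i' j') ** P) $ k $ l
     = (transpose P ** B i j ** P) $ k $ l - s * (transpose P ** B i' j' ** P) $ k $ l" for k l
    unfolding conj sum_distrib_left sum_subtractf[symmetric] by (intro sum.cong refl) (simp add: algebra_simps)
  then have "transpose P ** (B i j - s *\<^sub>R B i' j') ** P = 0"
    using ft unfolding frame_tensor_congruence B_def by (simp add: vec_eq_iff)
  then have "B i j - s *\<^sub>R B i' j' = 0" by (rule congruence_zero[OF P])
  then have "(B i j - s *\<^sub>R B i' j') $ p $ q = 0" by simp
  then show ?thesis unfolding B_def by simp
qed

section \<open>The Hodge star in a unitary frame\<close>

lemma det_4:
  "det (A::'a::comm_ring_1^4^4) =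
    A$1$1 * (A$2$2 * (A$3$3 * A$4$4 - A$3$4 * A$4$3) - A$2$3 * (A$3$2 * A$4$4 - A$3$4 * A$4$2) + A$2$4 * (A$3$2 * A$4$3 - A$3$3 * A$4$2))
  - A$1$2 * (A$2$1 * (A$3$3 * A$4$4 - A$3$4 * A$4$3) - A$2$3 * (A$3$1 * A$4$4 - A$3$4 * A$4$1) + A$2$4 * (A$3$1 * A$4$3 - A$3$3 * A$4$1))
  + A$1$3 * (A$2$1 * (A$3$2 * A$4$4 - A$3$4 * A$4$2) - A$2$2 * (A$3$1 * A$4$4 - A$3$4 * A$4$1) + A$2$4 * (A$3$1 * A$4$2 - A$3$2 * A$4$1))
  - A$1$4 * (A$2$1 * (A$3$2 * A$4$3 - A$3$3 * A$4$2) - A$2$2 * (A$3$1 * A$4$3 - A$3$3 * A$4$1) + A$2$3 * (A$3$1 * A$4$2 - A$3$2 * A$4$1))"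
proof -
  have f1234: "finite {2::4, 3, 4}" "1 \<notin> {2::4, 3, 4}" by auto
  have f234: "finite {3::4, 4}" "2 \<notin> {3::4, 4}" by auto
  have f34: "finite {4::4}" "3 \<notin> {4::4}" by auto
  show ?thesis
    unfolding det_def UNIV_4
    unfolding sum_over_permutations_insert[OF f1234]
    unfolding sum_over_permutations_insert[OF f234]
    unfolding sum_over_permutations_insert[OF f34]
    unfolding permutes_sing
    by (simp add: sign_swap_id permutation_swap_id permutation_compose sign_compose sign_id swap_id_eq algebra_simps)
qed

lemma det_rows_4: "det (vector [u, v, w, x] :: real^4^4) =
 u$1 * (v$2 * (w$3 * x$4 - w$4 * x$3) - v$3 * (w$2 * x$4 - w$4 * x$2) + v$4 * (w$2 * x$3 - w$3 * x$2))
  - u$2 * (v$1 * (w$3 * x$4 - w$4 * x$3) - v$3 * (w$1 * x$4 - w$4 * x$1) + v$4 * (w$1 * x$3 - w$3 * x$1))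
  + u$3 * (v$1 * (w$2 * x$4 - w$4 * x$2) - v$2 * (w$1 * x$4 - w$4 * x$1) + v$4 * (w$1 * x$2 - w$2 * x$1))
  - u$4 * (v$1 * (w$2 * x$3 - w$3 * x$2) - v$2 * (w$1 * x$3 - w$3 * x$1) + v$3 * (w$1 * x$2 - w$2 * x$1))"
  by (simp add: det_4)

text \<open>Summing the Levi-Civita symbol over its last two indices leaves the two permutations that complete the
  first pair.\<close>

lemma levi_civita_pairs:
  "(\<Sum>c\<in>UNIV. \<Sum>d\<in>UNIV. det (vector [axis a 1, axis b 1, axis c 1, axis d 1] :: real^4^4) * M c d)
   = (if (a, b) = (1, 2) then M 3 4 - M 4 3 else if (a, b) = (2, 1) then M 4 3 - M 3 4
      else if (a, b) = (1, 3) then M 4 2 - M 2 4 else if (a, b) = (3, 1) then M 2 4 - M 4 2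
      else if (a, b) = (1, 4) then M 2 3 - M 3 2 else if (a, b) = (4, 1) then M 3 2 - M 2 3
      else if (a, b) = (2, 3) then M 1 4 - M 4 1 else if (a, b) = (3, 2) then M 4 1 - M 1 4
      else if (a, b) = (2, 4) then M 3 1 - M 1 3 else if (a, b) = (4, 2) then M 1 3 - M 3 1
      else if (a, b) = (3, 4) then M 1 2 - M 2 1 else if (a, b) = (4, 3) then M 2 1 - M 1 2 else 0)"
proof -
  have ax: "axis (i::4) (1::real) $ j = (if i = j then 1 else 0)" for i j by (simp add: axis_def)
  have ne: "(1::4) \<noteq> 2" "(1::4) \<noteq> 3" "(1::4) \<noteq> 4" "(2::4) \<noteq> 3" "(2::4) \<noteq> 4" "(3::4) \<noteq> 4" by simp_all
  show ?thesis unfolding sum_4 det_rows_4 ax using exhaust_4[of a] exhaust_4[of b]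
    by (elim disjE; hypsubst; simp only: ne ne[symmetric] if_False if_True simp_thms prod.inject mult_zero_left mult_zero_right
      mult_1_left mult_1_right diff_0_right add_0_left add_0_right diff_self diff_0 mult_minus_left add_uminus_conv_diff minus_zero uminus_add_conv_diff)
qed

text \<open>Columns are the real coordinates of \<open>X\<close>, \<open>\<i> X\<close>, \<open>Y\<close>, \<open>\<i> Y\<close> for \<open>X = (x, 0)\<close> and \<open>Y = (y, r)\<close>: Gram-Schmidt
  applied to the standard basis gives a unitary frame of this triangular shape, whose determinant is
  explicit and positive.\<close>

definition frame_matrix :: "real \<Rightarrow> complex \<Rightarrow> real \<Rightarrow> real^4^4" where
  "frame_matrix x y r = vector [vector [x, 0, Re y, - Im y], vector [0, x, Im y, Re y], vector [0, 0, r, 0], vector [0, 0, 0, r]]"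

lemma frame_matrix_simps [simp]:
  "frame_matrix x y r $ 1 $ 1 = x" "frame_matrix x y r $ 1 $ 2 = 0" "frame_matrix x y r $ 1 $ 3 = Re y" "frame_matrix x y r $ 1 $ 4 = - Im y"
  "frame_matrix x y r $ 2 $ 1 = 0" "frame_matrix x y r $ 2 $ 2 = x" "frame_matrix x y r $ 2 $ 3 = Im y" "frame_matrix x y r $ 2 $ 4 = Re y"
  "frame_matrix x y r $ 3 $ 1 = 0" "frame_matrix x y r $ 3 $ 2 = 0" "frame_matrix x y r $ 3 $ 3 = r" "frame_matrix x y r $ 3 $ 4 = 0"
  "frame_matrix x y r $ 4 $ 1 = 0" "frame_matrix x y r $ 4 $ 2 = 0" "frame_matrix x y r $ 4 $ 3 = 0" "frame_matrix x y r $ 4 $ 4 = r"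
  by (simp_all add: frame_matrix_def)

lemma det_frame_matrix: "det (frame_matrix x y r) = x\<^sup>2 * r\<^sup>2"
  by (simp add: det_4 power2_eq_square)

text \<open>The frame is compatible with the complex structure, so passing to it sends vectors of type \<open>(1,0)\<close> to
  vectors of type \<open>(1,0)\<close>.\<close>

lemma t10_frame_matrix:
  "t10 (U $ 1 *s vector [of_real x, 0] + U $ 2 *s vector [y, of_real r]) a
    = (\<Sum>i\<in>UNIV. of_real (frame_matrix x y r $ a $ i) * t10 U i)"
  using exhaust_4[of a] by (elim disjE; hypsubst; simp add: sum_4 complex_eq_iff algebra_simps add_divide_distrib diff_divide_distrib)

lemma t01_frame_matrix:
  "t01 (U $ 1 *s vector [of_real x, 0] + U $ 2 *s vector [y, of_real r]) a
    = (\<Sum>i\<in>UNIV. of_real (frame_matrix x y r $ a $ i) * t01 U i)"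
  using exhaust_4[of a] by (elim disjE; hypsubst; simp add: sum_4 complex_eq_iff algebra_simps add_divide_distrib diff_divide_distrib)

text \<open>In the orthonormal oriented frame \<open>P\<close> the Hodge star exchanges the pairs \<open>12\<close> and \<open>34\<close>, \<open>13\<close> and
  \<open>42\<close>, \<open>14\<close> and \<open>23\<close>. The triangular shape of \<open>P\<close> makes the transformation to the coordinate
  frame an explicit polynomial identity.\<close>

lemma hodge_star_self_dual:
  assumes inv: "matrix_inv G = P ** transpose P" and P: "P = frame_matrix x y r" and xr: "x \<noteq> 0" "r \<noteq> 0"
    and det: "sqrt (det G) = 1 / (x\<^sup>2 * r\<^sup>2)"
    and anti: "\<And>a b. \<omega> b a = - \<omega> a b"
    and sd: "two_form_component P \<omega> 1 2 = two_form_component P \<omega> 3 4"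
      "two_form_component P \<omega> 1 3 = - two_form_component P \<omega> 2 4"
      "two_form_component P \<omega> 1 4 = two_form_component P \<omega> 2 3"
  shows "hodge_star G \<omega> a b = \<omega> a b"
proof -
  define M where "M c d = (\<Sum>p\<in>UNIV. \<Sum>q\<in>UNIV. matrix_inv G $ c $ p * matrix_inv G $ d $ q * \<omega> p q)" for c d
  let ?b = "two_form_component P \<omega>" and ?O = "\<chi> p q. \<omega> p q"
  have M: "M c d = (\<Sum>i\<in>UNIV. \<Sum>j\<in>UNIV. P $ c $ i * P $ d $ j * ?b i j)" for c d
  proof -
    have b: "(\<chi> i j. ?b i j) = transpose P ** ?O ** P"
      by (simp add: vec_eq_iff congruence_entry two_form_component_def transpose_def ac_simps)
    have "M c d = (matrix_inv G ** ?O ** transpose (matrix_inv G)) $ c $ d"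
      by (simp add: M_def congruence_entry transpose_def ac_simps)
    also have "matrix_inv G ** ?O ** transpose (matrix_inv G) = P ** (transpose P ** ?O ** P) ** transpose P"
      by (simp add: inv matrix_transpose_mul matrix_mul_assoc)
    also have "\<dots> $ c $ d = (\<Sum>i\<in>UNIV. \<Sum>j\<in>UNIV. P $ c $ i * P $ d $ j * ?b i j)"
      unfolding b[symmetric] by (simp add: congruence_entry transpose_def ac_simps)
    finally show ?thesis .
  qed
  have "\<omega> a a = 0" for a using anti[of a a] by simp
  note \<omega> = this anti[of 2 1] anti[of 3 1] anti[of 4 1] anti[of 3 2] anti[of 4 2] anti[of 4 3]
  have b: "?b 1 2 = x * x * \<omega> 1 2" "?b 1 3 = x * (Im y * \<omega> 1 2 + r * \<omega> 1 3)" "?b 1 4 = x * (Re y * \<omega> 1 2 + r * \<omega> 1 4)"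
    "?b 2 3 = x * (r * \<omega> 2 3 - Re y * \<omega> 1 2)" "?b 2 4 = x * (Im y * \<omega> 1 2 + r * \<omega> 2 4)"
    "?b 3 4 = (Re y * Re y + Im y * Im y) * \<omega> 1 2 + r * (Im y * \<omega> 1 3 - Re y * \<omega> 2 3 + Re y * \<omega> 1 4 + Im y * \<omega> 2 4) + r * r * \<omega> 3 4"
    by (simp_all add: two_form_component_def P sum_4 \<omega>) (simp_all add: algebra_simps)
  have b': "?b i i = 0" "?b j i = - ?b i j" for i j
  proof -
    show "?b j i = - ?b i j" for i j
    proof -
      have "P $ p $ j * P $ q $ i * \<omega> p q = - (P $ q $ i * P $ p $ j * \<omega> q p)" for p q
        using anti[of p q] by simp
      then show ?thesis unfolding two_form_component_def sum_negf[symmetric] by (subst sum.swap) (intro sum.cong refl)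
    qed
    from this[of i i] show "?b i i = 0" by simp
  qed
  note b' = b'(1) b'(2)[of 2 1] b'(2)[of 3 1] b'(2)[of 4 1] b'(2)[of 3 2] b'(2)[of 4 2] b'(2)[of 4 3]
  have anti_M: "M d c = - M c d" for c d
  proof -
    have "matrix_inv G $ d $ p * matrix_inv G $ c $ q * \<omega> p q
        = - (matrix_inv G $ c $ q * matrix_inv G $ d $ p * \<omega> q p)" for p q
      using anti[of p q] by simp
    then show ?thesis unfolding M_def sum_negf[symmetric] by (subst sum.swap) (intro sum.cong refl)
  qed
  have M1: "M 3 4 = r * r * ?b 3 4" "M 2 4 = r * (x * ?b 2 4 + Im y * ?b 3 4)" "M 2 3 = r * (x * ?b 2 3 - Re y * ?b 3 4)"
    "M 1 4 = r * (x * ?b 1 4 + Re y * ?b 3 4)" "M 1 3 = r * (x * ?b 1 3 + Im y * ?b 3 4)"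
    "M 1 2 = x * x * ?b 1 2 + x * Im y * (?b 1 3 + ?b 2 4) + x * Re y * (?b 1 4 - ?b 2 3) + (Re y * Re y + Im y * Im y) * ?b 3 4"
    unfolding M sum_4 P frame_matrix_simps b'[unfolded P] by (simp_all add: algebra_simps)
  have key: "M 3 4 = x * x * r * r * \<omega> 1 2" "M 2 4 = - (x * x * r * r * \<omega> 1 3)" "M 2 3 = x * x * r * r * \<omega> 1 4"
     "M 1 4 = x * x * r * r * \<omega> 2 3" "M 1 3 = - (x * x * r * r * \<omega> 2 4)"
    using sd unfolding M1 sd(1)[symmetric] b(1-5) by - (algebra+)
  \<comment> \<open>Only for the pair \<open>34\<close> is the common factor \<open>x\<close> of the last two relations to be cancelled first.\<close>
  have "x * (2 * Im y * \<omega> 1 2 + r * (\<omega> 1 3 + \<omega> 2 4)) = 0" "x * (2 * Re y * \<omega> 1 2 + r * (\<omega> 1 4 - \<omega> 2 3)) = 0"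
    using sd(2,3) unfolding b by - (algebra+)
  then have "2 * Im y * \<omega> 1 2 + r * (\<omega> 1 3 + \<omega> 2 4) = 0" "2 * Re y * \<omega> 1 2 + r * (\<omega> 1 4 - \<omega> 2 3) = 0"
    using xr by simp_all
  then have key': "M 1 2 = x * x * r * r * \<omega> 3 4"
    using sd unfolding M1 b by algebra
  have hodge: "hodge_star G \<omega> a b = sqrt (det G) * (\<Sum>c\<in>UNIV. \<Sum>d\<in>UNIV. det (vector [axis a 1, axis b 1, axis c 1, axis d 1] :: real^4^4) * M c d) / 2" for a b
    unfolding hodge_star_def vol_form_def M_def
    by (simp add: sum_distrib_left mult.assoc)
  note M' = anti_M[of 2 1] anti_M[of 3 1] anti_M[of 4 1] anti_M[of 3 2] anti_M[of 4 2] anti_M[of 4 3]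
  have hodge_1: "hodge_star G \<omega> 1 2 = \<omega> 1 2" "hodge_star G \<omega> 1 3 = \<omega> 1 3" "hodge_star G \<omega> 1 4 = \<omega> 1 4"
    "hodge_star G \<omega> 2 3 = \<omega> 2 3" "hodge_star G \<omega> 2 4 = \<omega> 2 4" "hodge_star G \<omega> 3 4 = \<omega> 3 4"
    unfolding hodge levi_civita_pairs det using xr by (simp_all add: M' key key' power2_eq_square)
  have anti_hodge: "hodge_star G \<omega> b a = - hodge_star G \<omega> a b" for a b
    unfolding hodge levi_civita_pairs using exhaust_4[of a] exhaust_4[of b] by (elim disjE; hypsubst; simp add: M')
  have "hodge_star G \<omega> a a = 0" for a using anti_hodge[of a a] by simp
  note hodge_2 = this anti_hodge[of 2 1] anti_hodge[of 3 1] anti_hodge[of 4 1] anti_hodge[of 3 2] anti_hodge[of 4 2] anti_hodge[of 4 3]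
  show ?thesis using exhaust_4[of a] exhaust_4[of b]
    by (elim disjE; hypsubst; simp only: hodge_2 hodge_1 \<omega>)
qed

section \<open>Self-duality\<close>

context hermitian_coordinates begin

lemma riem_metric_herm:
  "(\<Sum>a\<in>UNIV. \<Sum>b\<in>UNIV. u a * riem_metric h w $ a $ b * v b)
    = 2 * Re (herm (h w) (vector [Complex (u 1) (u 2), Complex (u 3) (u 4)]) (vector [Complex (v 1) (v 2), Complex (v 3) (v 4)]))"
  by (simp add: riem_metric_def sum_4 herm_2) (simp add: algebra_simps)

text \<open>The normalisation to \<open>1/2\<close> compensates the factor \<open>2\<close> in the Riemannian metric.\<close>

lemma orthonormal_frame:
  assumes w: "w \<in> S"
  obtains x y r where "x > 0" "r > 0"
    "2 * herm (h w) (vector [of_real x, 0]) (vector [of_real x, 0]) = 1"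
    "2 * herm (h w) (vector [y, of_real r]) (vector [y, of_real r]) = 1"
    "herm (h w) (vector [of_real x, 0]) (vector [y, of_real r]) = 0"
proof -
  define a where "a = Re (h w $ 1 $ 1)"
  define y0 where "y0 = - (h w $ 2 $ 1) / h w $ 1 $ 1"
  have a: "a > 0" using pos[OF w, of "vector [1, 0]"] by (simp add: herm_2 a_def vec_eq_iff forall_2)
  have h11: "h w $ 1 $ 1 = of_real a" using hermitian[OF w, of 1 1] by (simp add: a_def complex_eq_iff)
  let ?Y = "vector [y0, 1] :: complex^2"
  define b where "b = Re (herm (h w) ?Y ?Y)"
  have b: "b > 0" using pos[OF w, of ?Y] by (simp add: b_def vec_eq_iff forall_2)
  have hY: "herm (h w) ?Y ?Y = of_real b" using herm_swap[OF w, of ?Y ?Y] by (simp add: b_def complex_eq_iff)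
  have orth: "herm (h w) (vector [1, 0]) ?Y = 0"
    using a hermitian[OF w, of 1 2] by (simp add: herm_2 y0_def h11 complex_cnj_divide)
  define x where "x = 1 / sqrt (2 * a)"
  define r where "r = 1 / sqrt (2 * b)"
  have x2: "2 * (x * x) * a = 1" and r2: "2 * (r * r) * b = 1" using a b by (simp_all add: x_def r_def)
  have scale: "herm (h w) (vector [of_real s * X1, of_real s * X2]) (vector [of_real t * Y1, of_real t * Y2])
      = of_real (s * t) * herm (h w) (vector [X1, X2]) (vector [Y1, Y2])" for s t X1 X2 Y1 Y2
    by (simp add: herm_2 algebra_simps)
  show ?thesis
  proof
    show "x > 0" "r > 0" using a b by (simp_all add: x_def r_def)
    show "2 * herm (h w) (vector [of_real x, 0]) (vector [of_real x, 0]) = 1"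
      using arg_cong[OF x2, of complex_of_real] by (simp add: herm_2 h11 ac_simps)
    show "2 * herm (h w) (vector [of_real r * y0, of_real r]) (vector [of_real r * y0, of_real r]) = 1"
      using scale[of r y0 1 r y0 1] arg_cong[OF r2, of complex_of_real] hY by (simp add: ac_simps)
    show "herm (h w) (vector [of_real x, 0]) (vector [of_real r * y0, of_real r]) = 0"
      using scale[of x 1 0 r y0 1] orth by simp
  qed
qed

lemma frame_matrix_orthonormal:
  assumes w: "w \<in> S"
    and "2 * herm (h w) (vector [of_real x, 0]) (vector [of_real x, 0]) = 1"
    and "2 * herm (h w) (vector [y, of_real r]) (vector [y, of_real r]) = 1"
    and "herm (h w) (vector [of_real x, 0]) (vector [y, of_real r]) = 0"
  shows "transpose (frame_matrix x y r) ** riem_metric h w ** frame_matrix x y r = mat 1"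
proof -
  define Z :: "4 \<Rightarrow> complex^2" where
    "Z i = (if i = 1 \<or> i = 2 then vector [of_real x, 0] else vector [y, of_real r])" for i
  define c :: "4 \<Rightarrow> complex" where "c i = (if i = 1 \<or> i = 3 then 1 else \<i>)" for i
  have col: "vector [Complex (frame_matrix x y r $ 1 $ i) (frame_matrix x y r $ 2 $ i),
      Complex (frame_matrix x y r $ 3 $ i) (frame_matrix x y r $ 4 $ i)] = c i *s Z i" for i
    using exhaust_4[of i] by (elim disjE; hypsubst; simp add: c_def Z_def vec_eq_iff forall_2 complex_eq_iff)
  have bil: "herm (h w) (s *s X) (t *s Y) = s * cnj t * herm (h w) X Y" for s t X Y
    by (simp add: herm_2 algebra_simps)
  have Z: "herm (h w) (Z i) (Z j) = (if (i = 1 \<or> i = 2) = (j = 1 \<or> j = 2) then 1 / 2 else 0)" for i j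
    using assms(2-4) herm_swap[OF w, of "vector [y, of_real r]" "vector [of_real x, 0]"]
    by (auto simp: Z_def field_simps)
  have "(transpose (frame_matrix x y r) ** riem_metric h w ** frame_matrix x y r) $ i $ j = mat 1 $ i $ j" for i j
    unfolding congruence_entry transpose_def vec_lambda_beta riem_metric_herm col bil Z
    using exhaust_4[of i] exhaust_4[of j] by (elim disjE; hypsubst; simp add: c_def mat_def)
  then show ?thesis by (simp add: vec_eq_iff)
qed

text \<open>The frame components of the Weyl tensor in a unitary frame satisfy the hypotheses of
  \<open>anti_self_dual_part_zero\<close>: orthogonal \<open>U\<close> and \<open>V\<close> in \<open>\<complex>\<^sup>2\<close> are the frame coordinates of orthogonal
  \<open>(1,0)\<close>-vectors.\<close>

theorem weyl_minus_zero:
  assumes w: "w \<in> S" and \<beta>: "\<beta> \<noteq> 0" and C: "\<And>X. X \<noteq> 0 \<Longrightarrow> mixed_curv k \<alpha> \<beta> h w X = C"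
  shows "weyl_minus real_frame (riem_metric h) w a b i j = 0"
proof -
  let ?G = "riem_metric h w" and ?W = "weyl real_frame (riem_metric h) w"
  obtain x y r where xr: "x > 0" "r > 0"
    and on: "2 * herm (h w) (vector [of_real x, 0]) (vector [of_real x, 0]) = 1"
    "2 * herm (h w) (vector [y, of_real r]) (vector [y, of_real r]) = 1"
    "herm (h w) (vector [of_real x, 0]) (vector [y, of_real r]) = 0"
    using orthonormal_frame[OF w] .
  define P where "P = frame_matrix x y r"
  have PGP: "transpose P ** ?G ** P = mat 1" unfolding P_def by (rule frame_matrix_orthonormal[OF w on])
  have detP: "det P = x\<^sup>2 * r\<^sup>2" unfolding P_def by (rule det_frame_matrix)
  then have invP: "invertible P" using xr by (simp add: invertible_det_nz)
  have Ginv: "matrix_inv ?G = P ** transpose P"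
  proof -
    have "P ** (transpose P ** ?G) = mat 1" using PGP matrix_left_right_inverse by blast
    then have "(P ** transpose P) ** ?G = mat 1" by (simp add: matrix_mul_assoc)
    then have "(P ** transpose P) ** (?G ** matrix_inv ?G) = matrix_inv ?G" by (simp add: matrix_mul_assoc)
    then show ?thesis by (simp add: matrix_inv_mult(2)[OF metric_invertible[OF w]])
  qed
  have detG: "sqrt (det ?G) = 1 / (x\<^sup>2 * r\<^sup>2)"
  proof -
    have "det P * det ?G * det P = 1" using arg_cong[OF PGP, of det] by (simp add: det_mul)
    then have "det ?G = (1 / (x\<^sup>2 * r\<^sup>2))\<^sup>2" unfolding detP using xr by (simp add: field_simps power2_eq_square)
    then show ?thesis by simp
  qed
  have W: "curvature_like ?W" by (rule curvature_like_weyl[OF w])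
  define T where "T = frame_tensor ?W (\<lambda>a i. P $ a $ i)"
  have T: "curvature_like T" unfolding T_def by (rule curvature_like_frame_tensor[OF W])
  have tr: "(\<Sum>i\<in>UNIV. T i j i l) = 0" for j l
    unfolding T_def
  proof (rule frame_tensor_trace)
    fix b d
    have "(\<Sum>i\<in>UNIV. P $ a $ i * P $ c $ i) = matrix_inv ?G $ a $ c" for a c
      by (simp add: Ginv matrix_matrix_mult_def transpose_def)
    then show "(\<Sum>a\<in>UNIV. \<Sum>c\<in>UNIV. (\<Sum>i\<in>UNIV. P $ a $ i * P $ c $ i) * ?W a b c d) = 0"
      using weyl_trace_free[OF w, of b d] by simp
  qed
  have null: "quadlin T (t10 U) (t01 V) (t10 U) (t01 V) = 0"
    if UV: "U \<noteq> 0" "V \<noteq> 0" "U $ 1 * cnj (V $ 1) + U $ 2 * cnj (V $ 2) = 0" for U V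
  proof -
    \<comment> \<open>The vector with frame coordinates \<open>U\<close>.\<close>
    define E :: "complex^2 \<Rightarrow> complex^2" where "E U = U $ 1 *s vector [of_real x, 0] + U $ 2 *s vector [y, of_real r]" for U
    have bil: "herm (h w) (s *s X + t *s Y) (s' *s X + t' *s Y) = s * cnj s' * herm (h w) X X + s * cnj t' * herm (h w) X Y
       + t * cnj s' * herm (h w) Y X + t * cnj t' * herm (h w) Y Y" for s t s' t' X Y
      by (simp add: herm_2 algebra_simps)
    have on': "herm (h w) (vector [of_real x, 0]) (vector [of_real x, 0]) = 1/2"
      "herm (h w) (vector [y, of_real r]) (vector [y, of_real r]) = 1/2"
      "herm (h w) (vector [y, of_real r]) (vector [of_real x, 0]) = 0"
      using on herm_swap[OF w, of "vector [y, of_real r]" "vector [of_real x, 0]"] by (simp_all add: field_simps)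
    have EE: "herm (h w) (E U) (E V) = (U $ 1 * cnj (V $ 1) + U $ 2 * cnj (V $ 2)) / 2" for U V
      unfolding E_def bil on(3) on' by (simp add: field_simps)
    have E0: "E U \<noteq> 0" if "U \<noteq> 0" for U
    proof
      assume "E U = 0"
      then have "E U $ 1 = 0" "E U $ 2 = 0" by simp_all
      then show False using xr that by (simp add: E_def vec_eq_iff forall_2)
    qed
    have t10: "t10 (E U) = (\<lambda>a. \<Sum>i\<in>UNIV. of_real (P $ a $ i) * t10 U i)"
      and t01: "t01 (E U) = (\<lambda>a. \<Sum>i\<in>UNIV. of_real (P $ a $ i) * t01 U i)" for U
      unfolding E_def P_def by (intro ext, rule t10_frame_matrix) (intro ext, rule t01_frame_matrix)
    have "herm (h w) (E U) (E V) = 0" using EE[of U V] UV(3) by simp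
    then have "quadlin ?W (t10 (E U)) (t01 (E V)) (t10 (E U)) (t01 (E V)) = 0"
      using weyl_null[OF w \<beta> C E0[OF UV(1)] E0[OF UV(2)]] by blast
    then show ?thesis unfolding t10 t01 T_def quadlin_frame_change .
  qed
  have sd: "T 1 2 k l = T 3 4 k l" "T 1 3 k l = - T 2 4 k l" "T 1 4 k l = T 2 3 k l" for k l
    by (rule anti_self_dual_part_zero[OF T tr null]; assumption)+
  have pair: "two_form_component P (\<lambda>p q. ?W p q i j) m n = s * two_form_component P (\<lambda>p q. ?W p q i j) m' n'"
    if "\<And>k l. T m n k l = s * T m' n' k l" for m n m' n' s
    by (rule frame_tensor_first_pair[OF invP that[unfolded T_def]])
  have "hodge_star ?G (\<lambda>p q. ?W p q i j) a b = ?W a b i j"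
  proof (rule hodge_star_self_dual[OF Ginv P_def _ _ detG])
    show "?W b a i j = - ?W a b i j" for a b by (rule curvature_likeD(1)[OF W])
    show "two_form_component P (\<lambda>p q. ?W p q i j) 1 2 = two_form_component P (\<lambda>p q. ?W p q i j) 3 4"
      using pair[of 1 2 1 3 4] sd(1) by simp
    show "two_form_component P (\<lambda>p q. ?W p q i j) 1 3 = - two_form_component P (\<lambda>p q. ?W p q i j) 2 4"
      using pair[of 1 3 "-1" 2 4] sd(2) by simp
    show "two_form_component P (\<lambda>p q. ?W p q i j) 1 4 = two_form_component P (\<lambda>p q. ?W p q i j) 2 3"
      using pair[of 1 4 1 2 3] sd(3) by simp
    show "x \<noteq> 0" "r \<noteq> 0" using xr by simp_all
  qed
  then show ?thesis unfolding weyl_minus_def by simp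
qed

end

theorem theorem1p1:
  fixes M :: "'a topology" and A :: "('a, 2) chart set"
    and g :: "('a, 2) chart \<Rightarrow> complex^2 \<Rightarrow> complex^2^2"
    and k :: nat and \<alpha> \<beta> :: real
  assumes "hermitian_manifold M A g"
    and "compact_space M"
    and "k \<in> {1, 2, 3, 4}"
    and "\<beta> \<noteq> 0"
    and "\<exists>C. constant_mixed_curvature A g k \<alpha> \<beta> C"
  shows "self_dual A g"
  unfolding self_dual_def
proof (intro ballI allI)
  fix c p a b i j assume c: "c \<in> A" and p: "p \<in> fst c"
  interpret hermitian_manifold M A g by (rule assms(1))
  interpret hermitian_coordinates "g c" "chart_image c"
    by standard (fact chart_image_open[OF c] metric_smooth[OF c] metric_hermitian[OF c] metric_pos[OF c])+
  obtain C where C: "constant_mixed_curvature A g k \<alpha> \<beta> C" using assms(5) by blast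
  have z: "snd c p \<in> chart_image c" using p by (simp add: chart_image_def)
  have "mixed_curv k \<alpha> \<beta> (g c) (snd c p) X = C" if "X \<noteq> 0" for X
    using C c p that unfolding constant_mixed_curvature_def by blast
  then show "weyl_minus real_frame (riem_metric (g c)) (snd c p) a b i j = 0"
    by (rule weyl_minus_zero[OF z assms(4)])
qed

end
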